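(* \textsc{PVC} is solvable in time $O^*(1.619^k)$, and \textsc{DPVC} is solvable in time $O^*(k^k)$, where $k$ is the number of vertices that receive a positive value in the optimal solution.
   Context: \textsc{Directed Power Vertex Cover (DPVC)}: the input is a finite simple undirected graph $G=(V,E)$ together with, for each edge $(u,v)\in E$, two positive integers $w_{u,v}$ and $w_{v,u}$. A feasible solution assigns to each $v\in V$ a value $p_v\ge 0$ such that for every edge $(u,v)\in E$ we have $p_u\ge w_{u,v}$ or $p_v\ge w_{v,u}$. The goal is to minimize the total power $\sum_{v\in V}p_v$. \textsc{Power Vertex Cover (PVC)} is the special case where $w_{u,v}=w_{v,u}$ for every edge. The parameter is $k$, the number of vertices that will receive a positive value in the optimal solution. The notation $O^*$ hides factors polynomial in the input size. *)

theory Defs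
  imports
    Complex_Main
    "HOL-Library.Log_Nat"
    "HOL-Computational_Algebra.Polynomial"
    "Graph_Theory.Pair_Digraph"
begin

section \<open>Directed Power Vertex Cover\<close>

text \<open>
  A finite simple undirected graph is a \<open>pair_graph\<close>: a finite, symmetric, loop-free set of arcs,
  so that an edge is a pair of opposite arcs. The two numbers attached to an edge with ends
  \<open>u\<close> and \<open>v\<close> are then \<open>w (u, v)\<close> (what \<open>u\<close> has to pay) and \<open>w (v, u)\<close> (what \<open>v\<close> has to pay).
\<close>

definition dpvc_instance :: "'v pair_pre_digraph \<Rightarrow> ('v \<times> 'v \<Rightarrow> nat) \<Rightarrow> bool" where
  "dpvc_instance G w \<longleftrightarrow> pair_graph G \<and> (\<forall>a \<in> parcs G. 0 < w a)"

definition pvc_instance :: "'v pair_pre_digraph \<Rightarrow> ('v \<times> 'v \<Rightarrow> nat) \<Rightarrow> bool" where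
  "pvc_instance G w \<longleftrightarrow> dpvc_instance G w \<and> (\<forall>(u, v) \<in> parcs G. w (u, v) = w (v, u))"

definition feasible :: "'v pair_pre_digraph \<Rightarrow> ('v \<times> 'v \<Rightarrow> nat) \<Rightarrow> ('v \<Rightarrow> real) \<Rightarrow> bool" where
  "feasible G w p \<longleftrightarrow>
     (\<forall>v \<in> pverts G. 0 \<le> p v) \<and>
     (\<forall>(u, v) \<in> parcs G. real (w (u, v)) \<le> p u \<or> real (w (v, u)) \<le> p v)"

definition total_power :: "'v pair_pre_digraph \<Rightarrow> ('v \<Rightarrow> real) \<Rightarrow> real" where
  "total_power G p = (\<Sum>v \<in> pverts G. p v)"

definition optimal :: "'v pair_pre_digraph \<Rightarrow> ('v \<times> 'v \<Rightarrow> nat) \<Rightarrow> ('v \<Rightarrow> real) \<Rightarrow> bool" where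
  "optimal G w p \<longleftrightarrow>
     feasible G w p \<and> (\<forall>q. feasible G w q \<longrightarrow> total_power G p \<le> total_power G q)"

definition num_positive :: "'v pair_pre_digraph \<Rightarrow> ('v \<Rightarrow> real) \<Rightarrow> nat" where
  "num_positive G p = card {v \<in> pverts G. 0 < p v}"


section \<open>Model of computation\<close>

text \<open>
  Programs are systems of first-order, call-by-value, mutually recursive functions over binary
  trees whose leaves are natural numbers. Time is measured by the logarithmic cost criterion: every
  evaluation step costs one unit, and an arithmetic operation costs in addition the bit lengths of
  its operands. An interpreter that represents trees by pointers to shared immutable cells
  simulates an evaluation of cost \<open>t\<close> on a multitape Turing machine in time polynomial in \<open>t\<close> and
  the input size, and conversely Turing machines are simulated with polynomial overhead, so the
  bounds below, which hide polynomial factors, do not depend on this choice of the model.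
\<close>

datatype val = Num nat | Node val val

datatype expr =
    Var nat                  \<comment> \<open>de Bruijn index into the environment\<close>
  | Const nat
  | Add expr expr
  | Sub expr expr            \<comment> \<open>truncated at 0\<close>
  | Less expr expr
  | MkNode expr expr
  | Left expr
  | Right expr
  | IsNode expr
  | IfNz expr expr expr      \<comment> \<open>the first branch is taken on nonzero numbers\<close>
  | LetIn expr expr
  | Call nat "expr list"

type_synonym program = "expr list"   \<comment> \<open>the bodies of the functions 0, 1, ...\<close>

abbreviation bits :: "nat \<Rightarrow> nat" where
  "bits n \<equiv> floorlog 2 n"

inductive eval :: "program \<Rightarrow> val list \<Rightarrow> expr \<Rightarrow> val \<Rightarrow> nat \<Rightarrow> bool"
  and evals :: "program \<Rightarrow> val list \<Rightarrow> expr list \<Rightarrow> val list \<Rightarrow> nat \<Rightarrow> bool"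
  for P :: program where
  Var: "i < length env \<Longrightarrow> eval P env (Var i) (env ! i) 1"
| Const: "eval P env (Const n) (Num n) 1"
| Add: "\<lbrakk>eval P env e1 (Num m) t1; eval P env e2 (Num n) t2\<rbrakk> \<Longrightarrow>
    eval P env (Add e1 e2) (Num (m + n)) (t1 + t2 + bits m + bits n + 1)"
| Sub: "\<lbrakk>eval P env e1 (Num m) t1; eval P env e2 (Num n) t2\<rbrakk> \<Longrightarrow>
    eval P env (Sub e1 e2) (Num (m - n)) (t1 + t2 + bits m + bits n + 1)"
| Less: "\<lbrakk>eval P env e1 (Num m) t1; eval P env e2 (Num n) t2\<rbrakk> \<Longrightarrow>
    eval P env (Less e1 e2) (Num (if m < n then 1 else 0)) (t1 + t2 + bits m + bits n + 1)"
| MkNode: "\<lbrakk>eval P env e1 v1 t1; eval P env e2 v2 t2\<rbrakk> \<Longrightarrow>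
    eval P env (MkNode e1 e2) (Node v1 v2) (t1 + t2 + 1)"
| Left: "eval P env e (Node v1 v2) t \<Longrightarrow> eval P env (Left e) v1 (t + 1)"
| Right: "eval P env e (Node v1 v2) t \<Longrightarrow> eval P env (Right e) v2 (t + 1)"
| IsNode_Num: "eval P env e (Num n) t \<Longrightarrow> eval P env (IsNode e) (Num 0) (t + 1)"
| IsNode_Node: "eval P env e (Node v1 v2) t \<Longrightarrow> eval P env (IsNode e) (Num 1) (t + 1)"
| IfNz_nonzero: "\<lbrakk>eval P env e (Num n) t; n \<noteq> 0; eval P env e1 v t1\<rbrakk> \<Longrightarrow>
    eval P env (IfNz e e1 e2) v (t + t1 + 1)"
| IfNz_zero: "\<lbrakk>eval P env e (Num 0) t; eval P env e2 v t2\<rbrakk> \<Longrightarrow>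
    eval P env (IfNz e e1 e2) v (t + t2 + 1)"
| LetIn: "\<lbrakk>eval P env e1 v1 t1; eval P (v1 # env) e2 v2 t2\<rbrakk> \<Longrightarrow>
    eval P env (LetIn e1 e2) v2 (t1 + t2 + 1)"
| Call: "\<lbrakk>evals P env es vs t1; f < length P; eval P vs (P ! f) v t2\<rbrakk> \<Longrightarrow>
    eval P env (Call f es) v (t1 + t2 + 1)"
| evals_Nil: "evals P env [] [] 0"
| evals_Cons: "\<lbrakk>eval P env e v t1; evals P env es vs t2\<rbrakk> \<Longrightarrow>
    evals P env (e # es) (v # vs) (t1 + t2)"

inductive_cases eval_elims:
  "eval P env (Var i) v t"
  "eval P env (Const n) v t"
  "eval P env (Add e1 e2) v t"
  "eval P env (Sub e1 e2) v t"
  "eval P env (Less e1 e2) v t"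
  "eval P env (MkNode e1 e2) v t"
  "eval P env (Left e) v t"
  "eval P env (Right e) v t"
  "eval P env (IsNode e) v t"
  "eval P env (IfNz e e1 e2) v t"
  "eval P env (LetIn e1 e2) v t"
  "eval P env (Call f es) v t"
  "evals P env [] vs t"
  "evals P env (e # es) vs t"

lemma eval_deterministic:
  "eval P env e v t \<Longrightarrow> eval P env e v' t' \<Longrightarrow> v' = v \<and> t' = t"
  "evals P env es vs t \<Longrightarrow> evals P env es vs' t' \<Longrightarrow> vs' = vs \<and> t' = t"
proof (induction arbitrary: v' t' and vs' t' rule: eval_evals.inducts)
  case Var
  from Var.prems show ?case by (elim eval_elims) simp_all
next
  case Const
  from Const.prems show ?case by (elim eval_elims) simp_all
next
  case Add
  from Add.prems show ?case by (elim eval_elims) (auto dest!: Add.IH(2,4))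
next
  case Sub
  from Sub.prems show ?case by (elim eval_elims) (auto dest!: Sub.IH(2,4))
next
  case Less
  from Less.prems show ?case by (elim eval_elims) (auto dest!: Less.IH(2,4))
next
  case MkNode
  from MkNode.prems show ?case by (elim eval_elims) (auto dest!: MkNode.IH(2,4))
next
  case Left
  from Left.prems show ?case by (elim eval_elims) (auto dest!: Left.IH(2))
next
  case Right
  from Right.prems show ?case by (elim eval_elims) (auto dest!: Right.IH(2))
next
  case IsNode_Num
  from IsNode_Num.prems show ?case by (elim eval_elims) (auto dest!: IsNode_Num.IH(2))
next
  case IsNode_Node
  from IsNode_Node.prems show ?case by (elim eval_elims) (auto dest!: IsNode_Node.IH(2))
next
  case IfNz_nonzero
  from IfNz_nonzero.prems show ?case by (elim eval_elims) (auto dest!: IfNz_nonzero.IH(2,4) simp: IfNz_nonzero.hyps)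
next
  case IfNz_zero
  from IfNz_zero.prems show ?case by (elim eval_elims) (auto dest!: IfNz_zero.IH(2,4))
next
  case LetIn
  from LetIn.prems show ?case by (elim eval_elims) (auto dest!: LetIn.IH(2,4))
next
  case Call
  from Call.prems show ?case by (elim eval_elims) (auto dest!: Call.IH(2,5))
next
  case evals_Nil
  from evals_Nil.prems show ?case by (elim eval_elims) simp_all
next
  case evals_Cons
  from evals_Cons.prems show ?case by (elim eval_elims) (auto dest!: evals_Cons.IH(2,4))
qed

definition runs :: "program \<Rightarrow> val \<Rightarrow> val \<Rightarrow> nat \<Rightarrow> bool" where
  "runs P x y t \<longleftrightarrow> eval P [x] (Call 0 [Var 0]) y t"

fun val_size :: "val \<Rightarrow> nat" where
  "val_size (Num n) = bits n + 1"
| "val_size (Node a b) = val_size a + val_size b + 1"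

fun encode_list :: "val list \<Rightarrow> val" where
  "encode_list [] = Num 0"
| "encode_list (x # xs) = Node x (encode_list xs)"


section \<open>Solvability in parameterized time\<close>

text \<open>
  Vertices are named by natural numbers. A graph is presented by a list of its vertices and
  a list of its arcs with their weights, each in an arbitrary order; weights are written in binary.
\<close>

definition encode_input ::
  "nat list \<Rightarrow> (nat \<times> nat) list \<Rightarrow> (nat \<times> nat \<Rightarrow> nat) \<Rightarrow> nat \<Rightarrow> val" where
  "encode_input vs as w k =
     Node (encode_list (map Num vs))
       (Node (encode_list (map (\<lambda>(u, v). Node (Node (Num u) (Num v)) (Num (w (u, v)))) as))
         (Num k))"

text \<open>
  The output lists the (integral) powers in the order in which the vertices were listed. Optimality
  is among all real-valued solutions.
\<close>

definition is_optimal_output ::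
  "nat pair_pre_digraph \<Rightarrow> (nat \<times> nat \<Rightarrow> nat) \<Rightarrow> nat list \<Rightarrow> val \<Rightarrow> bool" where
  "is_optimal_output G w vs y \<longleftrightarrow>
     (\<exists>p :: nat \<Rightarrow> nat. optimal G w (\<lambda>v. real (p v)) \<and>
        y = encode_list (map (\<lambda>v. Num (p v)) vs))"

text \<open>
  Solvability in time \<open>O\<^sup>*(f k)\<close>, where the parameter \<open>k\<close> is part of the input, as usual for
  parameterized problems: one program halts within the time bound for every instance and every
  \<open>k\<close>, and it returns an optimal solution whenever \<open>k\<close> is the number of vertices that receive
  a positive value in some optimal solution.
\<close>

definition solvable_in_O_star ::
  "(nat pair_pre_digraph \<Rightarrow> (nat \<times> nat \<Rightarrow> nat) \<Rightarrow> bool) \<Rightarrow> (nat \<Rightarrow> real) \<Rightarrow> bool" where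
  "solvable_in_O_star inst f \<longleftrightarrow>
     (\<exists>(P :: program) (q :: nat poly).
        \<forall>G w vs as k.
          inst G w \<and> distinct vs \<and> set vs = pverts G \<and> distinct as \<and> set as = parcs G \<longrightarrow>
          (\<exists>y t. runs P (encode_input vs as w k) y t \<and>
             real t \<le> real (poly q (val_size (encode_input vs as w k))) * f k \<and>
             ((\<exists>p. optimal G w p \<and> num_positive G p = k) \<longrightarrow> is_optimal_output G w vs y)))"

end

theory Submission
  imports Defs
begin

text \<open>
  Both algorithms are bounded search trees over an instance given by clauses ``\<open>p u \<ge> a\<close> or
  \<open>p x \<ge> b\<close>''; fixing \<open>p v = c\<close> removes \<open>v\<close>, and a clause in which \<open>v\<close> does not pay enough
  becomes a demand on the other end alone.

  For PVC, let \<open>W\<close> be the largest number such that some vertex \<open>u\<close> has two incident edges of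
  weight at least \<open>W\<close>, leading to \<open>x\<close> and \<open>y\<close>. The edges heavier than \<open>W\<close> form a matching.
  If \<open>p v \<ge> W\<close> but \<open>p v\<close> is less than the largest weight at \<open>v\<close>, then the partner of \<open>v\<close> in the
  matching pays for their edge and can hand all of its power above \<open>W\<close> over to \<open>v\<close>. So some optimal
  solution gives the full weight either to \<open>u\<close> (if \<open>p u \<ge> W\<close>), or to \<open>x\<close> and then to \<open>y\<close>
  (otherwise), and the number of nodes obeys \<open>T k = T (k - 1) + T (k - 2) + 1\<close>.

  For DPVC, one end \<open>v\<close> of any clause is positive. Every weight at \<open>v\<close> above \<open>p v\<close> belongs to another
  positive vertex, so \<open>p v\<close> is one of the \<open>k\<close> largest distinct weights at \<open>v\<close>. This gives
  \<open>T k = 2 * k * T (k - 1) + 1\<close>, and \<open>2 ^ k * fact k \<le> 2 * k ^ k\<close>.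
\<close>

section \<open>The search algorithms\<close>

text \<open>
  The clause \<open>(u, a, x, b)\<close> means \<open>a \<le> p u \<or> b \<le> p x\<close>. A demand \<open>a \<le> p u\<close> is the loop
  \<open>(u, a, u, a)\<close>. Clause lists are kept symmetric, so the weights at a vertex \<open>v\<close> can be read off
  the clauses with first component \<open>v\<close>.
\<close>

type_synonym clause = "nat \<times> nat \<times> nat \<times> nat"
text \<open>\<open>None\<close> reports that the search found no solution within its budget of
  positive vertices; \<open>Some (s, L)\<close> carries the cost \<open>s\<close> and the chosen
  vertices with their powers.\<close>

type_synonym result = "(nat \<times> (nat \<times> nat) list) option"

fun assign :: "nat \<Rightarrow> nat \<Rightarrow> clause list \<Rightarrow> clause list" where
  "assign v c [] = []"
| "assign v c ((u, a, x, b) # C) =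
    (if u = v then assign v c C
     else if x = v then (if c < b then (u, a, u, a) # assign v c C else assign v c C)
     else (u, a, x, b) # assign v c C)"

definition add :: "nat \<Rightarrow> nat \<Rightarrow> result \<Rightarrow> result" where
  "add v c = map_option (\<lambda>(s, L). (s + c, (v, c) # L))"

fun better :: "result \<Rightarrow> result \<Rightarrow> result" where
  "better None r = r"
| "better (Some p) None = Some p"
| "better (Some p) (Some q) = (if fst p < fst q then Some p else Some q)"

section \<open>The search tree for PVC\<close>

fun maxw :: "nat \<Rightarrow> clause list \<Rightarrow> nat" where
  "maxw v [] = 0"
| "maxw v ((u, a, x, b) # C) = (if u = v then max a (maxw v C) else maxw v C)"

text \<open>Looks for a second edge at \<open>u\<close>, not leading to \<open>x\<close> and of
  weight at least \<open>a\<close>. If there is one, then \<open>a\<close> is a candidate for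
  \<open>W\<close>.\<close>

fun partner :: "nat \<Rightarrow> nat \<Rightarrow> nat \<Rightarrow> clause list \<Rightarrow> nat option" where
  "partner u a x [] = None"
| "partner u a x ((u', a', x', b') # C) =
    (if u' = u then if x' = x then partner u a x C else if a' < a then partner u a x C else Some x'
     else partner u a x C)"

fun heavier :: "clause \<Rightarrow> nat option \<Rightarrow> clause option \<Rightarrow> clause option" where
  "heavier d None r = r"
| "heavier (u, a, x, b) (Some y) None = Some (a, u, x, y)"
| "heavier (u, a, x, b) (Some y) (Some (a', h)) = (if a' < a then Some (a, u, x, y) else Some (a', h))"

text \<open>The result \<open>(W, u, x, y)\<close> has the type \<open>clause\<close> only because
  it is a quadruple of numbers. The list \<open>D\<close> is scanned, while partners are sought in
  the whole list \<open>C\<close>.\<close>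

fun heavy :: "clause list \<Rightarrow> clause list \<Rightarrow> clause option" where
  "heavy [] C = None"
| "heavy ((u, a, x, b) # D) C = heavier (u, a, x, b) (partner u a x C) (heavy D C)"

definition set_max :: "(clause list \<Rightarrow> result) \<Rightarrow> nat \<Rightarrow> clause list \<Rightarrow> result" where
  "set_max f v C = add v (maxw v C) (f (assign v (maxw v C) C))"

definition branch_pvc :: "(clause list \<Rightarrow> result) \<Rightarrow> (clause list \<Rightarrow> result) \<Rightarrow> clause list \<Rightarrow> result" where
  "branch_pvc f g C =
    (case C of
      [] \<Rightarrow> Some (0, [])
    | d # _ \<Rightarrow>
      (case heavy C C of
        None \<Rightarrow> set_max f (fst d) C
      | Some (a, u, x, y) \<Rightarrow> better (set_max f u C) (set_max (set_max g y) x C)))"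

text \<open>The budget \<open>k - 1\<close> is truncated: from budget 1, the second branch may fix
  two vertices. This does no harm, because a result only has to be a feasible solution; the budget
  limits the depth of the search.\<close>

fun solve_pvc :: "nat \<Rightarrow> clause list \<Rightarrow> result" where
  "solve_pvc 0 = (\<lambda>C. if C = [] then Some (0, []) else None)"
| "solve_pvc (Suc k) = branch_pvc (solve_pvc k) (solve_pvc (k - 1))"

section \<open>The search tree for DPVC\<close>

fun weights :: "nat \<Rightarrow> clause list \<Rightarrow> nat list" where
  "weights v [] = []"
| "weights v ((u, a, x, b) # C) = (if u = v then List.insert a (weights v C) else weights v C)"

fun loopw :: "nat \<Rightarrow> clause list \<Rightarrow> nat" where
  "loopw v [] = 0"
| "loopw v ((u, a, x, b) # C) = (if u = v then if x = v then max a (loopw v C) else loopw v C else loopw v C)"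

fun count_gt :: "nat \<Rightarrow> nat list \<Rightarrow> nat" where
  "count_gt a [] = 0"
| "count_gt a (b # L) = (if a < b then Suc (count_gt a L) else count_gt a L)"

text \<open>\<open>M\<close> stays the full list of distinct weights while \<open>L\<close> is
  consumed. The tests keep the weights that meet the demand \<open>l\<close> and have fewer than
  \<open>k\<close> larger ones, which leaves at most \<open>k\<close> candidates.\<close>

primrec try_all :: "(nat \<Rightarrow> result) \<Rightarrow> nat list \<Rightarrow> nat list \<Rightarrow> nat \<Rightarrow> nat \<Rightarrow> result" where
  "try_all f [] M l k = None"
| "try_all f (a # L) M l k =
    (if a < l then try_all f L M l k
     else if count_gt a M < k then better (f a) (try_all f L M l k)
     else try_all f L M l k)"

definition branch_dpvc :: "(clause list \<Rightarrow> result) \<Rightarrow> nat \<Rightarrow> nat \<Rightarrow> clause list \<Rightarrow> result" where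
  "branch_dpvc f k v C =
    try_all (\<lambda>c. add v c (f (assign v c C))) (weights v C) (weights v C) (loopw v C) k"

primrec solve_dpvc :: "nat \<Rightarrow> clause list \<Rightarrow> result" where
  "solve_dpvc 0 = (\<lambda>C. if C = [] then Some (0, []) else None)"
| "solve_dpvc (Suc k) = (\<lambda>C. case C of [] \<Rightarrow> Some (0, [])
    | (u, a, x, b) # _ \<Rightarrow>
      better (branch_dpvc (solve_dpvc k) (Suc k) u C) (branch_dpvc (solve_dpvc k) (Suc k) x C))"

section \<open>Clauses and partial assignments\<close>

definition sat :: "(nat \<Rightarrow> real) \<Rightarrow> clause list \<Rightarrow> bool" where
  "sat p C \<longleftrightarrow> (\<forall>u a x b. (u, a, x, b) \<in> set C \<longrightarrow> real a \<le> p u \<or> real b \<le> p x)"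

definition symm :: "clause list \<Rightarrow> bool" where
  "symm C \<longleftrightarrow> (\<forall>u a x b. (u, a, x, b) \<in> set C \<longrightarrow> (x, b, u, a) \<in> set C)"

lemma assign_iff:
  "(u, a, x, b) \<in> set (assign v c C) \<longleftrightarrow> u \<noteq> v \<and> x \<noteq> v \<and>
     ((u, a, x, b) \<in> set C \<or> x = u \<and> b = a \<and> (\<exists>b'>c. (u, a, v, b') \<in> set C))"
  by (induction v c C rule: assign.induct) auto

lemma length_assign_le: "length (assign v c C) \<le> length C"
  by (induction v c C rule: assign.induct) (auto intro: le_SucI)

lemma length_assign_less: "(v, a, x, b) \<in> set C \<Longrightarrow> length (assign v c C) < length C"
  by (induction v c C rule: assign.induct) (auto simp: le_imp_less_Suc length_assign_le less_SucI)

lemma symm_assign: "symm C \<Longrightarrow> symm (assign v c C)"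
  unfolding symm_def assign_iff by blast

lemma set_weights: "set (weights v C) = {a. \<exists>x b. (v, a, x, b) \<in> set C}"
  by (induction v C rule: weights.induct) auto

lemma distinct_weights: "distinct (weights v C)"
  by (induction v C rule: weights.induct) auto

lemma maxw_ge: "(v, a, x, b) \<in> set C \<Longrightarrow> a \<le> maxw v C"
  by (induction v C rule: maxw.induct) auto

lemma maxw_in: "0 < maxw v C \<Longrightarrow> \<exists>x b. (v, maxw v C, x, b) \<in> set C"
  by (induction v C rule: maxw.induct) (auto simp: max_def split: if_splits)

lemma loopw_le_iff: "loopw v C \<le> c \<longleftrightarrow> (\<forall>a b. (v, a, v, b) \<in> set C \<longrightarrow> a \<le> c)"
  by (induction v C rule: loopw.induct) auto

lemma count_gt: "count_gt a L = length (filter (\<lambda>b. a < b) L)"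
  by (induction L) auto

definition achieves :: "result \<Rightarrow> real \<Rightarrow> bool" where
  "achieves r x \<longleftrightarrow> (\<exists>s L. r = Some (s, L) \<and> real s \<le> x)"

lemma achieves_better: "achieves r1 x \<or> achieves r2 x \<Longrightarrow> achieves (better r1 r2) x"
  unfolding achieves_def
  by (cases "(r1, r2)" rule: better.cases) (auto split: if_splits)

lemma achieves_add: "achieves r (x - c) \<Longrightarrow> achieves (add v c r) x"
  unfolding achieves_def add_def by auto

lemma achieves_try_all:
  "a \<in> set L \<Longrightarrow> l \<le> a \<Longrightarrow> count_gt a M < k \<Longrightarrow> achieves (f a) x \<Longrightarrow> achieves (try_all f L M l k) x"
  by (induction L) (auto intro: achieves_better)

text \<open>The solutions that either search may return, with their costs.\<close>

inductive derivable :: "clause list \<Rightarrow> nat \<Rightarrow> (nat \<times> nat) list \<Rightarrow> bool" where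
  "derivable [] 0 []"
| "derivable (assign v c C) s L \<Longrightarrow> (v, c, x, b) \<in> set C \<Longrightarrow> \<forall>a b. (v, a, v, b) \<in> set C \<longrightarrow> a \<le> c
    \<Longrightarrow> derivable C (s + c) ((v, c) # L)"

fun lookup :: "(nat \<times> nat) list \<Rightarrow> nat \<Rightarrow> nat" where
  "lookup [] v = 0"
| "lookup ((u, c) # L) v = (if u = v then c else lookup L v)"

text \<open>Since \<open>assign v c\<close> removes \<open>v\<close> from all clauses, this shows
  that no vertex is fixed twice; a new head of the list therefore never shadows a later pair, and
  costs add up.\<close>

lemma derivable_fst: "derivable C s L \<Longrightarrow> u \<in> fst ` set L \<Longrightarrow> \<exists>a x b. (u, a, x, b) \<in> set C"
proof (induction rule: derivable.induct)
  case (2 v c C s L x b)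
  then show ?case by (cases "u = v") (auto simp: assign_iff)
qed auto

lemma lookup_notin: "v \<notin> fst ` set L \<Longrightarrow> lookup L v = 0"
  by (induction L v rule: lookup.induct) auto

lemma derivable_sat: "derivable C s L \<Longrightarrow> symm C \<Longrightarrow> sat (\<lambda>v. real (lookup L v)) C"
proof (induction rule: derivable.induct)
  case (2 v c C s L x b)
  then have IH: "sat (\<lambda>v. real (lookup L v)) (assign v c C)" by (simp add: symm_assign)
  have "real a' \<le> real (lookup ((v, c) # L) u) \<or> real b' \<le> real (lookup ((v, c) # L) y)"
    if "(u, a', y, b') \<in> set C" for u a' y b'
  proof -
    have "(y, b', u, a') \<in> set C" using 2(5) that by (auto simp: symm_def)
    \<comment> \<open>If neither end is \<open>v\<close>, the clause survives. If exactly one end is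
      \<open>v\<close> and \<open>c\<close> does not pay for it, the demand on the other end
      survives. If both ends are \<open>v\<close>, the condition on loops applies.\<close>
    then show ?thesis
      using IH[unfolded sat_def, rule_format, of u a' y b'] IH[unfolded sat_def, rule_format, of u a' u a']
        IH[unfolded sat_def, rule_format, of y b' y b'] that 2(3)
      by (auto simp: assign_iff not_less[symmetric])
  qed
  then show ?case by (auto simp: sat_def)
qed (auto simp: sat_def)

lemma derivable_sum:
  "derivable C s L \<Longrightarrow> finite V \<Longrightarrow> \<forall>u a x b. (u, a, x, b) \<in> set C \<longrightarrow> u \<in> V \<Longrightarrow> (\<Sum>v\<in>V. lookup L v) = s"
proof (induction rule: derivable.induct)
  case (2 v c C s L x b)
  have "v \<in> V" using 2(2,6) by auto
  have "v \<notin> fst ` set L" using derivable_fst[OF 2(1)] by (auto simp: assign_iff)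
  then have "lookup L v = 0" by (rule lookup_notin)
  moreover have "(\<Sum>v\<in>V. lookup L v) = s" using 2(4)[OF 2(5)] 2(6) by (auto simp: assign_iff)
  moreover have "(\<Sum>u\<in>V-{v}. lookup ((v, c) # L) u) = (\<Sum>u\<in>V-{v}. lookup L u)"
    by (rule sum.cong) auto
  ultimately show ?case using \<open>v \<in> V\<close> 2(5) by (simp add: sum.remove[of V v])
qed auto

text \<open>One bound serves for vertex names and weights alike, since the programs compare both and
  a comparison is charged for the bits of its operands.\<close>

definition bnd :: "nat \<Rightarrow> clause list \<Rightarrow> bool" where
  "bnd A C \<longleftrightarrow> (\<forall>u a x b. (u, a, x, b) \<in> set C \<longrightarrow> u \<le> A \<and> a \<le> A \<and> x \<le> A \<and> b \<le> A)"

lemma bnd_assign: "bnd A C \<Longrightarrow> bnd A (assign v c C)"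
  unfolding bnd_def assign_iff by blast

lemma derivable_bound: "derivable C s L \<Longrightarrow> bnd A C \<Longrightarrow> \<forall>(v, c) \<in> set L. v \<le> A"
proof (induction rule: derivable.induct)
  case (2 v c C s L x b)
  then have "v \<le> A" by (auto simp: bnd_def)
  then show ?case using 2 by (auto simp: bnd_assign)
qed simp

lemma better_cases: "better r1 r2 = Some z \<Longrightarrow> r1 = Some z \<or> r2 = Some z"
  by (cases "(r1, r2)" rule: better.cases) (auto split: if_splits)

lemma add_eq_Some: "add v c r = Some (s, L) \<longleftrightarrow> (\<exists>s' L'. r = Some (s', L') \<and> s = s' + c \<and> L = (v, c) # L')"
  by (auto simp: add_def)

section \<open>Positive vertices and cost after an assignment\<close>

definition positives :: "nat set \<Rightarrow> (nat \<Rightarrow> real) \<Rightarrow> nat" where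
  "positives V p = card {v \<in> V. 0 < p v}"

definition over :: "nat set \<Rightarrow> clause list \<Rightarrow> bool" where
  "over V C \<longleftrightarrow> (\<forall>u a x b. (u, a, x, b) \<in> set C \<longrightarrow> u \<in> V \<and> x \<in> V \<and> 0 < a \<and> 0 < b)"

lemma over_assign: "over V C \<Longrightarrow> over V (assign v c C)"
  unfolding over_def assign_iff by blast

text \<open>The vertex \<open>v\<close> no longer occurs after the assignment, so its power can be
  reset to 0. A new demand comes from a weight above \<open>c\<close> at \<open>v\<close>; by
  assumption \<open>p v\<close> does not pay for that weight, so the other end does.\<close>

lemma sat_assign:
  assumes "sat p C" "\<And>u a b. (u, a, v, b) \<in> set C \<Longrightarrow> real b \<le> p v \<Longrightarrow> b \<le> c"
  shows "sat (p(v := 0)) (assign v c C)"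
  unfolding sat_def assign_iff
proof (intro allI impI, elim conjE)
  fix u a x b
  assume "u \<noteq> v" "x \<noteq> v" and disj: "(u, a, x, b) \<in> set C \<or> x = u \<and> b = a \<and> (\<exists>b'>c. (u, a, v, b') \<in> set C)"
  from disj show "real a \<le> (p(v := 0)) u \<or> real b \<le> (p(v := 0)) x"
  proof
    assume "(u, a, x, b) \<in> set C"
    then show ?thesis using assms(1) \<open>u \<noteq> v\<close> \<open>x \<noteq> v\<close> by (auto simp: sat_def)
  next
    assume "x = u \<and> b = a \<and> (\<exists>b'>c. (u, a, v, b') \<in> set C)"
    then obtain b' where "b' > c" "(u, a, v, b') \<in> set C" "x = u" "b = a" by blast
    then have "real a \<le> p u \<or> real b' \<le> p v" using assms(1) by (auto simp: sat_def)
    then show ?thesis using assms(2) \<open>b' > c\<close> \<open>(u, a, v, b') \<in> set C\<close> \<open>u \<noteq> v\<close> by fastforce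
  qed
qed

lemma positives_upd_zero:
  assumes "finite V" "v \<in> V" "0 < p v"
  shows "Suc (positives V (p(v := 0))) = positives V p"
proof -
  have "{u \<in> V. 0 < p u} = insert v {u \<in> V. 0 < (p(v := 0)) u}" using assms by auto
  then show ?thesis using assms(1) unfolding positives_def by (simp add: card_insert_if)
qed

lemma sum_upd_zero:
  assumes "finite V" "v \<in> V"
  shows "(\<Sum>u\<in>V. (p(v := 0)) u) = (\<Sum>u\<in>V. p u) - (p v :: real)"
proof -
  have "(\<Sum>u\<in>V. (p(v := 0)) u) = (\<Sum>u\<in>V - {v}. p u)"
    using assms by (simp add: sum.remove[of V v])
  then show ?thesis using assms by (simp add: sum.remove[of V v])
qed

section \<open>Correctness of the branching for DPVC\<close>

lemma try_all_cases:
  "try_all f L M l k = Some z \<Longrightarrow> \<exists>a\<in>set L. l \<le> a \<and> f a = Some z"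
  by (induction L) (auto split: if_splits dest!: better_cases)

lemma branch_dpvc_derivable:
  assumes "branch_dpvc f k v C = Some (s, L)" "\<And>C s L. f C = Some (s, L) \<Longrightarrow> derivable C s L"
  shows "derivable C s L"
proof -
  obtain c where c: "c \<in> set (weights v C)" "loopw v C \<le> c" "add v c (f (assign v c C)) = Some (s, L)"
    using try_all_cases[OF assms(1)[unfolded branch_dpvc_def]] by blast
  then obtain x b s' L' where *: "(v, c, x, b) \<in> set C" "f (assign v c C) = Some (s', L')"
    "s = s' + c" "L = (v, c) # L'"
    by (auto simp: set_weights add_eq_Some)
  show ?thesis unfolding *(3,4)
    by (rule derivable.intros(2)[OF assms(2)[OF *(2)] *(1)]) (use c(2) in \<open>simp add: loopw_le_iff\<close>)
qed

lemma solve_dpvc_derivable: "solve_dpvc k C = Some (s, L) \<Longrightarrow> derivable C s L"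
proof (induction k arbitrary: C s L)
  case 0
  then show ?case by (auto split: if_splits intro: derivable.intros)
next
  case (Suc k)
  show ?case
  proof (cases C)
    case Nil
    then show ?thesis using Suc.prems by (auto intro: derivable.intros)
  next
    case (Cons d D)
    obtain u a x b where d: "d = (u, a, x, b)" by (cases d)
    then have "branch_dpvc (solve_dpvc k) (Suc k) u C = Some (s, L) \<or>
        branch_dpvc (solve_dpvc k) (Suc k) x C = Some (s, L)"
      using Suc.prems Cons by (intro better_cases) simp
    then show ?thesis using branch_dpvc_derivable Suc.IH by blast
  qed
qed

text \<open>Reflects that the graph is simple: the two ends of a clause determine its weights. Loops
  are exempt, since several fixed neighbours can each leave a demand on the same vertex.\<close>

definition coherent :: "clause list \<Rightarrow> bool" where
  "coherent C \<longleftrightarrow> symm C \<and> (\<forall>u a b. (u, a, u, b) \<in> set C \<longrightarrow> b = a) \<and>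
    (\<forall>u x a a' b b'. (u, a, x, b) \<in> set C \<longrightarrow> (u, a', x, b') \<in> set C \<longrightarrow> u \<noteq> x \<longrightarrow> a = a')"

lemma coherent_assign: "coherent C \<Longrightarrow> coherent (assign v c C)"
  unfolding coherent_def assign_iff by (intro conjI symm_assign; blast)

text \<open>Rounding \<open>p v\<close> down to \<open>c\<close>, the largest weight at
  \<open>v\<close> that it pays, satisfies the same clauses at no greater cost. The rest of the
  argument shows that \<open>c\<close> passes the tests of \<open>try_all\<close>.\<close>

lemma achieves_branch_dpvc:
  assumes sat: "sat p C" and "over V C" and coh: "coherent C" and "finite V" "\<forall>v\<in>V. 0 \<le> p v"
    and pos: "positives V p \<le> Suc k" and cl: "(v, a, x, b) \<in> set C" "real a \<le> p v"
    and IH: "\<And>p c. sat p (assign v c C) \<Longrightarrow> \<forall>v\<in>V. 0 \<le> p v \<Longrightarrow> positives V p \<le> k \<Longrightarrow>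
      achieves (f (assign v c C)) (\<Sum>v\<in>V. p v)"
  shows "achieves (branch_dpvc f (Suc k) v C) (\<Sum>v\<in>V. p v)"
proof -
  have "symm C" and loop: "(u, a, u, b) \<in> set C \<Longrightarrow> b = a"
    and func: "(u, a, x, b) \<in> set C \<Longrightarrow> (u, a', x, b') \<in> set C \<Longrightarrow> u \<noteq> x \<Longrightarrow> a = a'" for u x a a' b b'
    using coh unfolding coherent_def by blast+
  let ?S = "{a \<in> set (weights v C). real a \<le> p v}"
  define c where "c = Max ?S"
  have "a \<in> ?S" using cl by (auto simp: set_weights)
  moreover have fin: "finite ?S" by simp
  ultimately have "c \<in> ?S" unfolding c_def by (intro Max_in) auto
  have c_max: "a' \<le> c" if "(v, a', x', b') \<in> set C" "real a' \<le> p v" for a' x' b'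
    unfolding c_def using that by (intro Max_ge[OF fin]) (auto simp: set_weights)
  have "v \<in> V" "0 < a" using cl assms(2) by (auto simp: over_def)
  then have "0 < p v" using cl(2) by linarith
  have pos_v: "Suc (positives V (p(v := 0))) = positives V p"
    by (rule positives_upd_zero) fact+
  have "achieves (f (assign v c C)) (\<Sum>u\<in>V. (p(v := 0)) u)"
  proof (rule IH)
    show "sat (p(v := 0)) (assign v c C)"
      using sat \<open>symm C\<close> unfolding symm_def by (intro sat_assign) (blast intro: c_max)+
    show "\<forall>u\<in>V. 0 \<le> (p(v := 0)) u" using \<open>\<forall>v\<in>V. 0 \<le> p v\<close> by simp
    show "positives V (p(v := 0)) \<le> k" using pos_v pos by linarith
  qed
  then have "achieves (f (assign v c C)) ((\<Sum>v\<in>V. p v) - c)"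
    using \<open>c \<in> ?S\<close> unfolding sum_upd_zero[OF \<open>finite V\<close> \<open>v \<in> V\<close>] achieves_def by force
  then have "achieves (add v c (f (assign v c C))) (\<Sum>v\<in>V. p v)" by (rule achieves_add)
  moreover have "loopw v C \<le> c"
    unfolding loopw_le_iff
  proof (intro allI impI)
    fix a b assume *: "(v, a, v, b) \<in> set C"
    then have "real a \<le> p v" using sat loop[OF *] unfolding sat_def by fastforce
    then show "a \<le> c" using c_max * by blast
  qed
  moreover have "count_gt c (weights v C) < Suc k"
  proof -
    \<comment> \<open>A weight above \<open>c\<close> is not paid by \<open>v\<close>, so the other
      end pays and is positive. It is not \<open>v\<close> itself, because a loop would then be
      violated.\<close>
    have "\<exists>y. y \<in> V \<and> 0 < p y \<and> y \<noteq> v \<and> (\<exists>b. (v, a, y, b) \<in> set C)"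
      if a: "a \<in> set (weights v C)" "c < a" for a
    proof -
      obtain y b where *: "(v, a, y, b) \<in> set C" using a by (auto simp: set_weights)
      then have "\<not> real a \<le> p v" using c_max a(2) by (metis not_less)
      moreover have "real a \<le> p v \<or> real b \<le> p y" "real a \<le> p v \<or> real b \<le> p y" "0 < b" "y \<in> V"
        using * sat \<open>over V C\<close> by (auto simp: sat_def over_def)
      moreover have "b = a" if "y = v"
        using loop * that by blast
      ultimately show ?thesis using * by (intro exI[of _ y]) auto
    qed
    then obtain g where g: "g a \<in> V \<and> 0 < p (g a) \<and> g a \<noteq> v \<and> (\<exists>b. (v, a, g a, b) \<in> set C)"
      if "a \<in> set (weights v C)" "c < a" for a
      by metis
    let ?T = "{a \<in> set (weights v C). c < a}"
    \<comment> \<open>By coherence, distinct weights at \<open>v\<close> lead to distinct vertices.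
      These are positive and differ from \<open>v\<close>, so there are at most \<open>k\<close> of
      them.\<close>
    have "inj_on g ?T"
    proof (rule inj_onI)
      fix a1 a2 assume "a1 \<in> ?T" "a2 \<in> ?T" "g a1 = g a2"
      then show "a1 = a2" using g[of a1] g[of a2] func by (metis (lifting) mem_Collect_eq)
    qed
    moreover have "g ` ?T \<subseteq> {u \<in> V. 0 < (p(v := 0)) u}" using g by auto
    ultimately have "card ?T \<le> positives V (p(v := 0))"
      unfolding positives_def using \<open>finite V\<close> by (intro card_inj_on_le[of g]) auto
    moreover have "count_gt c (weights v C) = card ?T"
      unfolding count_gt using distinct_weights
      by (metis distinct_card distinct_filter set_filter)
    ultimately show ?thesis using pos_v pos by simp
  qed
  ultimately show ?thesis
    unfolding branch_dpvc_def using \<open>c \<in> ?S\<close> by (intro achieves_try_all[of c]) auto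
qed

lemma achieves_solve_dpvc:
  assumes "finite V"
  shows "sat p C \<Longrightarrow> over V C \<Longrightarrow> coherent C \<Longrightarrow> \<forall>v\<in>V. 0 \<le> p v \<Longrightarrow> positives V p \<le> k \<Longrightarrow>
    achieves (solve_dpvc k C) (\<Sum>v\<in>V. p v)"
proof (induction k arbitrary: p C)
  case 0
  have "C = []"
  proof (rule ccontr)
    assume "C \<noteq> []"
    then obtain u a x b where *: "(u, a, x, b) \<in> set C" by (cases C) auto
    have "{v \<in> V. 0 < p v} = {}" using 0(5) assms by (simp add: positives_def)
    moreover have "real a \<le> p u \<or> real b \<le> p x" "u \<in> V" "x \<in> V" "0 < a" "0 < b"
      using * 0(1,2) by (auto simp: sat_def over_def)
    ultimately show False by force
  qed
  then show ?case using 0 by (auto simp: achieves_def sum_nonneg)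
next
  case (Suc k)
  show ?case
  proof (cases C)
    case Nil
    then show ?thesis using Suc.prems by (auto simp: achieves_def sum_nonneg)
  next
    case (Cons d D)
    obtain u a x b where d: "d = (u, a, x, b)" by (cases d)
    have br: "achieves (branch_dpvc (solve_dpvc k) (Suc k) v C) (\<Sum>v\<in>V. p v)"
      if "(v, a, x, b) \<in> set C" "real a \<le> p v" for v a x b
      using Suc.prems(1-3) assms Suc.prems(4,5) that
      by (rule achieves_branch_dpvc) (rule Suc.IH; simp add: Suc.prems over_assign coherent_assign)
    have "(u, a, x, b) \<in> set C" using Cons d by simp
    moreover have "(x, b, u, a) \<in> set C"
      using Suc.prems(3) calculation unfolding coherent_def symm_def by blast
    moreover have "real a \<le> p u \<or> real b \<le> p x"
      using Suc.prems(1) calculation unfolding sat_def by blast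
    ultimately show ?thesis using br Cons d by (auto intro!: achieves_better)
  qed
qed

section \<open>Correctness of the branching for PVC\<close>

lemma partner_Some: "partner u a x C = Some y \<Longrightarrow> y \<noteq> x \<and> (\<exists>a' b'. (u, a', y, b') \<in> set C \<and> a \<le> a')"
  by (induction u a x C rule: partner.induct) (auto split: if_splits)

lemma partner_None: "partner u a x C = None \<Longrightarrow> (u, a', y, b') \<in> set C \<Longrightarrow> y \<noteq> x \<Longrightarrow> a' < a"
  by (induction u a x C rule: partner.induct) (auto split: if_splits)

lemma heavy_None: "heavy D C = None \<Longrightarrow> (u, a, x, b) \<in> set D \<Longrightarrow> partner u a x C = None"
proof (induction D C rule: heavy.induct)
  case (2 u' a' x' b' D C)
  then show ?case
    by (cases "((u', a', x', b'), partner u' a' x' C, heavy D C)" rule: heavier.cases) (auto split: if_splits)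
qed simp

lemma heavy_Some:
  "heavy D C = Some (a, u, x, y) \<Longrightarrow> (\<exists>b. (u, a, x, b) \<in> set D) \<and> partner u a x C = Some y \<and>
    (\<forall>u' a' x' b'. (u', a', x', b') \<in> set D \<longrightarrow> partner u' a' x' C \<noteq> None \<longrightarrow> a' \<le> a)"
proof (induction D C arbitrary: a u x y rule: heavy.induct)
  case (2 u' a' x' b' D C)
  show ?case
  proof (cases "((u', a', x', b'), partner u' a' x' C, heavy D C)" rule: heavier.cases)
    case (1 d r)
    then show ?thesis using 2 by force
  next
    case (2 u1 a1 x1 b1 y1)
    then show ?thesis using "2.prems" heavy_None[of D C] by auto
  next
    case (3 u1 a1 x1 b1 y1 a2 h)
    obtain u0 x0 y0 where h: "h = (u0, x0, y0)" by (cases h)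
    note IH = "2.IH"[of a2 u0 x0 y0]
    show ?thesis
    proof (cases "a2 < a1")
      case True
      then have "a = a1" "u = u1" "x = x1" "y = y1" using "2.prems" 3 by auto
      moreover have "\<forall>u a x b. (u, a, x, b) \<in> set D \<longrightarrow> partner u a x C \<noteq> None \<longrightarrow> a \<le> a1"
        using IH 3 h True by fastforce
      ultimately show ?thesis using 3 by auto
    next
      case False
      then have "a = a2" "u = u0" "x = x0" "y = y0" using "2.prems" 3 h by auto
      then show ?thesis using IH 3 h False by auto
    qed
  qed
qed simp

text \<open>The edges heavier than \<open>W\<close> form a matching: at each vertex they all lead to
  the same neighbour.\<close>

definition second_le :: "nat \<Rightarrow> clause list \<Rightarrow> bool" where
  "second_le W C \<longleftrightarrow> (\<forall>u a x b a' y b'. (u, a, x, b) \<in> set C \<longrightarrow> (u, a', y, b') \<in> set C \<longrightarrow> x \<noteq> y \<longrightarrow> a \<le> W \<or> a' \<le> W)"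

text \<open>Of two clauses at \<open>u\<close> with different ends, one that is not heavier has the
  other as a partner. Without partners the whole graph is a matching, and the exchange below applies
  with \<open>W = 0\<close>.\<close>

lemma second_le_heavy_None: assumes "heavy C C = None" shows "second_le 0 C"
  unfolding second_le_def
proof (intro allI impI)
  fix u a x b a' y b'
  assume *: "(u, a, x, b) \<in> set C" "(u, a', y, b') \<in> set C" "x \<noteq> y"
  then have "a' < a" "a < a'" using heavy_None[OF assms] partner_None by metis+
  then show "a \<le> 0 \<or> a' \<le> 0" by simp
qed

lemma second_le_heavy_Some: assumes "heavy C C = Some (W, h)" shows "second_le W C"
  unfolding second_le_def
proof (intro allI impI)
  fix u a x b a' y b'
  obtain u0 x0 y0 where h: "h = (u0, x0, y0)" by (cases h)
  assume *: "(u, a, x, b) \<in> set C" "(u, a', y, b') \<in> set C" "x \<noteq> y"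
  show "a \<le> W \<or> a' \<le> W"
  proof (cases "a \<le> a'")
    case True
    then have "partner u a x C \<noteq> None" using partner_None *(2,3) by (metis not_le)
    then show ?thesis using heavy_Some[OF assms[unfolded h]] *(1) by blast
  next
    case False
    then have "partner u a' y C \<noteq> None" using partner_None *(1,3) by (metis nat_le_linear not_le)
    then show ?thesis using heavy_Some[OF assms[unfolded h]] *(2) by blast
  qed
qed

text \<open>The invariant of the search for PVC. Every fixed vertex receives its full weight there,
  so no demands, that is, no loops, ever arise.\<close>

definition plain :: "clause list \<Rightarrow> bool" where
  "plain C \<longleftrightarrow> coherent C \<and> (\<forall>u a x b. (u, a, x, b) \<in> set C \<longrightarrow> x \<noteq> u \<and> b = a)"

lemma plainD:
  assumes "plain C" "(u, a, x, b) \<in> set C"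
  shows "(x, a, u, a) \<in> set C" "b = a" "x \<noteq> u"
  using assms unfolding plain_def coherent_def symm_def by blast+

text \<open>The largest weight at \<open>v\<close> pays for every clause at \<open>v\<close>, so the
  assignment merely deletes the vertex.\<close>

lemma assign_maxw_iff:
  assumes "plain C"
  shows "(u, a, x, b) \<in> set (assign v (maxw v C) C) \<longleftrightarrow> u \<noteq> v \<and> x \<noteq> v \<and> (u, a, x, b) \<in> set C"
proof -
  have "\<not> b > maxw v C" if "(u, a, v, b) \<in> set C" for u a b
    using assms that maxw_ge unfolding plain_def coherent_def symm_def by (metis not_less)
  then show ?thesis by (auto simp: assign_iff)
qed

lemma plain_assign: "plain C \<Longrightarrow> plain (assign v (maxw v C) C)"
  using coherent_assign[of C v "maxw v C"] assign_maxw_iff[of C] unfolding plain_def by blast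

text \<open>Lets the second branch treat \<open>y\<close> with the same \<open>W\<close> that was
  found before \<open>x\<close> was fixed.\<close>

lemma second_le_assign: "plain C \<Longrightarrow> second_le W C \<Longrightarrow> second_le W (assign v (maxw v C) C)"
  unfolding second_le_def assign_maxw_iff by blast

lemma set_max_derivable:
  assumes "set_max f v C = Some (s, L)" "plain C" "(v, a, x, b) \<in> set C" "0 < a"
    and "\<And>s L. f (assign v (maxw v C) C) = Some (s, L) \<Longrightarrow> derivable (assign v (maxw v C) C) s L"
  shows "derivable C s L"
proof -
  have "0 < maxw v C" using maxw_ge[OF assms(3)] assms(4) by simp
  then obtain y b' where "(v, maxw v C, y, b') \<in> set C" using maxw_in by blast
  then show ?thesis
    using assms(1,2,5) unfolding set_max_def add_eq_Some plain_def
    by (metis derivable.intros(2))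
qed

lemma solve_pvc_derivable:
  "solve_pvc k C = Some (s, L) \<Longrightarrow> plain C \<Longrightarrow> over V C \<Longrightarrow> derivable C s L"
proof (induction k arbitrary: C s L rule: solve_pvc.induct)
  case 1
  then show ?case by (auto split: if_splits intro: derivable.intros)
next
  case (2 k)
  show ?case
  proof (cases C)
    case Nil
    then show ?thesis using "2.prems" by (auto simp: branch_pvc_def intro: derivable.intros)
  next
    case (Cons d D)
    have sm: "derivable C s L" if "set_max (solve_pvc k) v C = Some (s, L)" "(v, a, x, b) \<in> set C"
      "plain C" "over V C" for v a x b s L C
    proof (rule set_max_derivable[OF that(1,3,2)])
      show "0 < a" using that(2,4) by (auto simp: over_def)
    qed (rule "2.IH"(1); simp add: plain_assign over_assign that)
    have sm': "derivable C s L" if "set_max (solve_pvc (k - 1)) v C = Some (s, L)" "(v, a, x, b) \<in> set C"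
      "plain C" "over V C" for v a x b s L C
    proof (rule set_max_derivable[OF that(1,3,2)])
      show "0 < a" using that(2,4) by (auto simp: over_def)
    qed (rule "2.IH"(2); simp add: plain_assign over_assign that)
    show ?thesis
    proof (cases "heavy C C")
      case None
      obtain v a x b where "d = (v, a, x, b)" by (cases d)
      then show ?thesis using "2.prems" None Cons
        by (intro sm[where v = v and a = a and x = x and b = b]) (auto simp: branch_pvc_def)
    next
      case (Some h)
      obtain W u x y where h: "h = (W, u, x, y)" by (cases h)
      note hs = heavy_Some[OF Some[unfolded h]]
      obtain b a' b' where *: "(u, W, x, b) \<in> set C" "y \<noteq> x" "(u, a', y, b') \<in> set C"
        using hs partner_Some by blast
      then have **: "(x, b, u, W) \<in> set C" "(y, b', u, a') \<in> set C" "u \<noteq> x"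
        using plainD[OF "2.prems"(2) *(1)] plainD[OF "2.prems"(2) *(3)] by auto
      then have "0 < b" using "2.prems"(3) unfolding over_def by blast
      \<comment> \<open>The edge between \<open>y\<close> and \<open>u\<close> avoids
        \<open>x\<close> and is still present, so the second vertex of the branch also receives a
        positive weight.\<close>
      have "(y, b', u, a') \<in> set (assign x (maxw x C) C)"
        using "2.prems"(2) * ** by (simp add: assign_maxw_iff)
      note sm'[OF _ this plain_assign over_assign, OF _ "2.prems"(2,3)]
      then have "derivable C s L" if "set_max (set_max (solve_pvc (k - 1)) y) x C = Some (s, L)"
        by (rule set_max_derivable[OF that "2.prems"(2) **(1) \<open>0 < b\<close>])
      moreover have "set_max (solve_pvc k) u C = Some (s, L) \<or>
          set_max (set_max (solve_pvc (k - 1)) y) x C = Some (s, L)"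
        using "2.prems"(1) Some h Cons by (intro better_cases) (simp add: branch_pvc_def)
      ultimately show ?thesis using sm[OF _ *(1) "2.prems"(2,3)] by blast
    qed
  qed
qed

text \<open>If \<open>p v\<close> is less than the largest weight at \<open>v\<close>, then the
  other end \<open>x\<close> of that edge pays for it. The edge is heavier than \<open>W\<close>, so
  all other edges at \<open>x\<close> weigh at most \<open>W\<close>: it suffices that
  \<open>x\<close> keeps \<open>W\<close> and passes the rest to \<open>v\<close>. The conclusion
  about \<open>min\<close> ensures that vertices with power at least \<open>W\<close> keep at least
  \<open>W\<close>.\<close>

lemma exchange:
  assumes "finite V" "over V C" "plain C" "second_le W C" "sat p C" "\<forall>v\<in>V. 0 \<le> p v" "real W \<le> p v"
    and cl: "(v, a, x, b) \<in> set C"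
  obtains q where "sat q C" "\<forall>v\<in>V. 0 \<le> q v" "real (maxw v C) \<le> q v" "positives V q \<le> positives V p"
    "(\<Sum>v\<in>V. q v) = (\<Sum>v\<in>V. p v)" "\<forall>y\<in>V. min (p y) W \<le> q y"
proof (cases "maxw v C \<le> p v")
  case True
  then show ?thesis using assms by (intro that[of p]) auto
next
  case False
  have "0 < a" "v \<in> V" using cl assms(2) by (auto simp: over_def)
  then have "0 < maxw v C" using maxw_ge[OF cl] by simp
  then obtain x b where "(v, maxw v C, x, b) \<in> set C" using maxw_in by blast
  moreover then have "b = maxw v C" "x \<noteq> v" using assms(3) by (auto simp: plain_def)
  ultimately have vx: "(v, maxw v C, x, maxw v C) \<in> set C" by simp
  then have xv: "(x, maxw v C, v, maxw v C) \<in> set C" "x \<in> V"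
    using assms(2,3) by (auto simp: over_def plain_def coherent_def symm_def)
  have px: "maxw v C \<le> p x" using False vx assms(5) by (auto simp: sat_def)
  have W: "W < maxw v C" using False assms(7) by simp
  have small: "a \<le> W" if "(x, a, y, b) \<in> set C" "y \<noteq> v" for a y b
    using assms(4) xv(1) that W unfolding second_le_def by (metis not_less)
  have only: "a = maxw v C" if "(x, a, v, b) \<in> set C" for a b
    using assms(3) that xv(1) \<open>x \<noteq> v\<close> unfolding plain_def coherent_def by blast
  define q where "q = p(x := real W, v := p v + p x - W)"
  have qx: "q x = W" and qv: "q v = p v + p x - W" and qy: "\<And>y. y \<noteq> x \<Longrightarrow> y \<noteq> v \<Longrightarrow> q y = p y"
    using \<open>x \<noteq> v\<close> by (auto simp: q_def)
  have mq: "maxw v C \<le> q v" "p v \<le> q v" using assms(7) px qv W by auto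
  \<comment> \<open>Only \<open>x\<close> loses power. Its edge to \<open>v\<close> is now paid by
    \<open>v\<close>, and its other edges weigh at most \<open>W\<close>, which \<open>x\<close>
    still has.\<close>
  have half: "a \<le> q u \<or> a \<le> q y" if "(u, a, y, b) \<in> set C" "a \<le> p u" for u a y b
  proof (cases "u = x")
    case True
    then show ?thesis using small only that mq qx by (cases "y = v") force+
  next
    case False
    then show ?thesis using that mq qy by (cases "u = v") auto
  qed
  have "sat q C"
    unfolding sat_def
  proof (intro allI impI)
    fix u a y b assume *: "(u, a, y, b) \<in> set C"
    then have "b = a" "(y, a, u, a) \<in> set C" using assms(3) unfolding plain_def coherent_def symm_def by blast+
    then show "real a \<le> q u \<or> real b \<le> q y"
      using half[of u a y a] half[of y a u a] * assms(5) unfolding sat_def by blast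
  qed
  moreover have "\<forall>y\<in>V. 0 \<le> q y" using assms(6) qx mq \<open>v \<in> V\<close> qy
    by (metis dual_order.trans of_nat_0_le_iff)
  moreover have "positives V q \<le> positives V p"
  \<comment> \<open>For \<open>W = 0\<close> the vertex \<open>v\<close> may become positive, but
    \<open>x\<close> drops to 0 in return. For \<open>W > 0\<close> both were positive
    before.\<close>
  proof (cases "W = 0")
    case True
    have "{y \<in> V. 0 < q y} \<subseteq> insert v ({y \<in> V. 0 < p y} - {x})"
      using True qx qy by force
    then have "positives V q \<le> card (insert v ({y \<in> V. 0 < p y} - {x}))"
      unfolding positives_def using assms(1) by (intro card_mono) auto
    also have "\<dots> \<le> Suc (card ({y \<in> V. 0 < p y} - {x}))" by (rule card_insert_le_m1) auto
    also have "\<dots> = positives V p"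
      unfolding positives_def using assms(1) px \<open>0 < maxw v C\<close> xv(2) by (intro card_Suc_Diff1) auto
    finally show ?thesis .
  next
    case False
    then have "0 < p x" "0 < p v" using px \<open>0 < maxw v C\<close> assms(7) by linarith+
    then have "{y \<in> V. 0 < q y} \<subseteq> {y \<in> V. 0 < p y}" using qy by fastforce
    then show ?thesis unfolding positives_def using assms(1) by (intro card_mono) auto
  qed
  moreover have "(\<Sum>v\<in>V. q v) = (\<Sum>v\<in>V. p v)"
  proof -
    have "(\<Sum>y\<in>V - {v} - {x}. q y) = (\<Sum>y\<in>V - {v} - {x}. p y)" using qy by (intro sum.cong) auto
    then show ?thesis using assms(1) \<open>v \<in> V\<close> xv(2) \<open>x \<noteq> v\<close> qx qv
      by (simp add: sum.remove[of V v] sum.remove[of "V - {v}" x])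
  qed
  moreover have "\<forall>y\<in>V. min (p y) W \<le> q y"
    using qx mq qy by (metis min.coboundedI1 min.coboundedI2 order_refl)
  ultimately show ?thesis using mq that by blast
qed

text \<open>The exchange first brings \<open>v\<close> to its full weight, and then \<open>v\<close>
  is removed. The lower bound on the powers of the other vertices allows a second step at another
  vertex.\<close>

lemma set_max_step:
  assumes "finite V" "over V C" "plain C" "second_le W C" "sat p C" "\<forall>v\<in>V. 0 \<le> p v" "real W \<le> p v"
    and cl: "(v, a, x, b) \<in> set C"
  obtains q where "sat q (assign v (maxw v C) C)" "\<forall>v\<in>V. 0 \<le> q v" "Suc (positives V q) \<le> positives V p"
    "(\<Sum>v\<in>V. q v) \<le> (\<Sum>v\<in>V. p v) - maxw v C" "\<forall>y\<in>V. y \<noteq> v \<longrightarrow> min (p y) W \<le> q y"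
proof -
  obtain q where q: "sat q C" "\<forall>v\<in>V. 0 \<le> q v" "real (maxw v C) \<le> q v" "positives V q \<le> positives V p"
    "(\<Sum>v\<in>V. q v) = (\<Sum>v\<in>V. p v)" "\<forall>y\<in>V. min (p y) W \<le> q y"
    using exchange[OF assms] by blast
  have "0 < a" "v \<in> V" using cl assms(2) by (auto simp: over_def)
  then have "0 < q v" using maxw_ge[OF cl] q(3) by simp
  have "sat (q(v := 0)) (assign v (maxw v C) C)"
  proof (rule sat_assign[OF q(1)])
    fix u a b assume "(u, a, v, b) \<in> set C"
    then have "(v, b, u, b) \<in> set C" using plainD[OF assms(3)] by blast
    then show "b \<le> maxw v C" by (rule maxw_ge)
  qed
  then show ?thesis
    using q positives_upd_zero[of V v q, OF \<open>finite V\<close> \<open>v \<in> V\<close> \<open>0 < q v\<close>] sum_upd_zero[OF \<open>finite V\<close> \<open>v \<in> V\<close>, of q]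
    by (intro that[of "q(v := 0)"]) auto
qed

lemma achieves_solve_pvc:
  assumes "finite V"
  shows "sat p C \<Longrightarrow> over V C \<Longrightarrow> plain C \<Longrightarrow> \<forall>v\<in>V. 0 \<le> p v \<Longrightarrow> positives V p \<le> k \<Longrightarrow>
    achieves (solve_pvc k C) (\<Sum>v\<in>V. p v)"
proof (induction k arbitrary: p C rule: solve_pvc.induct)
  case 1
  have "C = []"
  proof (rule ccontr)
    assume "C \<noteq> []"
    then obtain u a x b where *: "(u, a, x, b) \<in> set C" by (cases C) auto
    have "{v \<in> V. 0 < p v} = {}" using 1(5) assms by (simp add: positives_def)
    moreover have "real a \<le> p u \<or> real b \<le> p x" "u \<in> V" "x \<in> V" "0 < a" "0 < b"
      using * 1(1,2) by (auto simp: sat_def over_def)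
    ultimately show False by force
  qed
  then show ?case using 1 by (auto simp: achieves_def sum_nonneg)
next
  case (2 k)
  note prems = "2.prems"
  show ?case
  proof (cases C)
    case Nil
    then show ?thesis using prems by (auto simp: branch_pvc_def achieves_def sum_nonneg)
  next
    case (Cons d D)
    have sm: "achieves (set_max (solve_pvc k) v C) (\<Sum>v\<in>V. p v)"
      if "second_le W C" "real W \<le> p v" "(v, a, x, b) \<in> set C" for v W a x b
    proof -
      note cl = that
      obtain q where q: "sat q (assign v (maxw v C) C)" "\<forall>v\<in>V. 0 \<le> q v" "Suc (positives V q) \<le> positives V p"
        "(\<Sum>v\<in>V. q v) \<le> (\<Sum>v\<in>V. p v) - maxw v C"
        using set_max_step[OF assms prems(2,3) cl(1) prems(1,4) cl(2,3)] .
      then have "achieves (solve_pvc k (assign v (maxw v C) C)) (\<Sum>v\<in>V. q v)"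
        using prems by (intro "2.IH"(1)) (auto intro: over_assign plain_assign)
      then show ?thesis using q(4) unfolding set_max_def by (intro achieves_add) (auto simp: achieves_def)
    qed
    show ?thesis
    proof (cases "heavy C C")
      case None
      obtain v a x b where "d = (v, a, x, b)" by (cases d)
      moreover then have "(v, a, x, b) \<in> set C" using Cons by simp
      moreover then have "0 \<le> p v" using prems by (auto simp: over_def)
      \<comment> \<open>With \<open>W = 0\<close> the condition \<open>W \<le> p v\<close> holds for
        every vertex, so there is no need to branch.\<close>
      ultimately show ?thesis using None Cons sm[of 0 v a x b] second_le_heavy_None[OF None]
        by (simp add: branch_pvc_def)
    next
      case (Some h)
      obtain W u x y where h: "h = (W, u, x, y)" by (cases h)
      have second_le: "second_le W C" using second_le_heavy_Some Some h by blast
      note hs = heavy_Some[OF Some[unfolded h]]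
      obtain b a' b' where *: "(u, W, x, b) \<in> set C" "y \<noteq> x" "(u, a', y, b') \<in> set C" "W \<le> a'"
        using hs partner_Some by blast
      then have **: "(x, b, u, W) \<in> set C" "(y, b', u, a') \<in> set C" "u \<noteq> x" "b = W" "b' = a'"
        using plainD[OF prems(3) *(1)] plainD[OF prems(3) *(3)] by auto
      then have "y \<in> V" using prems(2) unfolding over_def by blast
      have "achieves (set_max (solve_pvc k) u C) (\<Sum>v\<in>V. p v) \<or>
        achieves (set_max (set_max (solve_pvc (k - 1)) y) x C) (\<Sum>v\<in>V. p v)"
      proof (cases "real W \<le> p u")
        case True
        then show ?thesis using sm[OF second_le True *(1)] by blast
      next
        case False
        \<comment> \<open>As \<open>u\<close> pays less than \<open>W\<close>, it pays for neither
          of the two edges, whose weights are \<open>W\<close> and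
          \<open>a' \<ge> W\<close>.\<close>
        then have "real W \<le> p x" "real W \<le> p y"
          using *(1,3,4) **(4,5) prems(1) unfolding sat_def by fastforce+
        let ?C = "assign x (maxw x C) C"
        obtain q where q: "sat q ?C" "\<forall>v\<in>V. 0 \<le> q v" "Suc (positives V q) \<le> positives V p"
          "(\<Sum>v\<in>V. q v) \<le> (\<Sum>v\<in>V. p v) - maxw x C" "\<forall>z\<in>V. z \<noteq> x \<longrightarrow> min (p z) W \<le> q z"
          using set_max_step[OF assms prems(2,3) second_le prems(1,4) \<open>real W \<le> p x\<close> **(1)] by blast
        \<comment> \<open>The step at \<open>x\<close> may take power from \<open>y\<close>, but it
          leaves at least \<open>W\<close>.\<close>
        have "real W \<le> q y" using q(5) \<open>y \<in> V\<close> *(2) \<open>real W \<le> p y\<close> by force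
        moreover have "(y, b', u, a') \<in> set ?C" using prems(3) * ** by (simp add: assign_maxw_iff)
        ultimately obtain q' where q': "sat q' (assign y (maxw y ?C) ?C)" "\<forall>v\<in>V. 0 \<le> q' v"
          "Suc (positives V q') \<le> positives V q" "(\<Sum>v\<in>V. q' v) \<le> (\<Sum>v\<in>V. q v) - maxw y ?C"
          using set_max_step[OF assms over_assign[OF prems(2)] plain_assign[OF prems(3)]
              second_le_assign[OF prems(3) second_le] q(1,2)] by blast
        have "achieves (solve_pvc (k - 1) (assign y (maxw y ?C) ?C)) (\<Sum>v\<in>V. q' v)"
          using prems q q' by (intro "2.IH"(2)) (auto intro: over_assign plain_assign)
        then have "achieves (set_max (solve_pvc (k - 1)) y ?C) ((\<Sum>v\<in>V. p v) - maxw x C)"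
          using q(4) q'(4) unfolding set_max_def by (intro achieves_add) (auto simp: achieves_def)
        then show ?thesis unfolding set_max_def[of "set_max _ _"] by (blast intro: achieves_add)
      qed
      then show ?thesis using Some h Cons by (auto simp: branch_pvc_def intro!: achieves_better)
    qed
  qed
qed

section \<open>Counting evaluation steps\<close>

text \<open>
  Here \<open>c\<close> counts evaluation steps. A step costs at most \<open>2 * N + 1\<close>, as all operands of arithmetic
  operations have at most \<open>N\<close> bits.
\<close>

definition ev :: "nat \<Rightarrow> program \<Rightarrow> val list \<Rightarrow> expr \<Rightarrow> val \<Rightarrow> nat \<Rightarrow> bool" where
  "ev N P env e v c \<longleftrightarrow> (\<exists>t. eval P env e v t \<and> t \<le> c * (2 * N + 1))"

definition evs :: "nat \<Rightarrow> program \<Rightarrow> val list \<Rightarrow> expr list \<Rightarrow> val list \<Rightarrow> nat \<Rightarrow> bool" where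
  "evs N P env es vs c \<longleftrightarrow> (\<exists>t. evals P env es vs t \<and> t \<le> c * (2 * N + 1))"

definition calls :: "nat \<Rightarrow> program \<Rightarrow> nat \<Rightarrow> val list \<Rightarrow> val \<Rightarrow> nat \<Rightarrow> bool" where
  "calls N P f vs v c \<longleftrightarrow> f < length P \<and> ev N P vs (P ! f) v c"

section \<open>Rules for symbolic evaluation\<close>

lemma ev_Var: "i < length env \<Longrightarrow> ev N P env (Var i) (env ! i) 1"
  unfolding ev_def using eval_evals.Var by fastforce

text \<open>Spelled out for each index in use, so that resolution yields the value itself and not a
  term \<open>env ! i\<close>.\<close>

lemma ev_Vars:
  "ev N P (v0 # env) (Var 0) v0 1"
  "ev N P (v0 # v1 # env) (Var 1) v1 1"
  "ev N P (v0 # v1 # v2 # env) (Var 2) v2 1"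
  "ev N P (v0 # v1 # v2 # v3 # env) (Var 3) v3 1"
  "ev N P (v0 # v1 # v2 # v3 # v4 # env) (Var 4) v4 1"
  "ev N P (v0 # v1 # v2 # v3 # v4 # v5 # env) (Var 5) v5 1"
  "ev N P (v0 # v1 # v2 # v3 # v4 # v5 # v6 # env) (Var 6) v6 1"
  "ev N P (v0 # v1 # v2 # v3 # v4 # v5 # v6 # v7 # env) (Var 7) v7 1"
  using ev_Var[of 0 "v0 # env"] ev_Var[of 1 "v0 # v1 # env"] ev_Var[of 2 "v0 # v1 # v2 # env"]
    ev_Var[of 3 "v0 # v1 # v2 # v3 # env"] ev_Var[of 4 "v0 # v1 # v2 # v3 # v4 # env"]
    ev_Var[of 5 "v0 # v1 # v2 # v3 # v4 # v5 # env"] ev_Var[of 6 "v0 # v1 # v2 # v3 # v4 # v5 # v6 # env"]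
    ev_Var[of 7 "v0 # v1 # v2 # v3 # v4 # v5 # v6 # v7 # env"]
  by simp_all

lemma ev_Const: "ev N P env (Const n) (Num n) 1"
  unfolding ev_def using eval_evals.Const by fastforce

lemma ev_mono: "ev N P env e v c \<Longrightarrow> v = v' \<Longrightarrow> c \<le> c' \<Longrightarrow> ev N P env e v' c'"
  unfolding ev_def by (meson le_trans mult_le_mono1)

lemma
  assumes "ev N P env e1 (Num m) c1" "ev N P env e2 (Num n) c2" "bits m \<le> N" "bits n \<le> N"
  shows ev_Add: "ev N P env (Add e1 e2) (Num (m + n)) (c1 + c2 + 1)"
    and ev_Sub: "ev N P env (Sub e1 e2) (Num (m - n)) (c1 + c2 + 1)"
    and ev_Less: "ev N P env (Less e1 e2) (Num (if m < n then 1 else 0)) (c1 + c2 + 1)"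
proof -
  obtain t1 t2 where t: "eval P env e1 (Num m) t1" "t1 \<le> c1 * (2 * N + 1)"
    "eval P env e2 (Num n) t2" "t2 \<le> c2 * (2 * N + 1)"
    using assms(1,2) unfolding ev_def by blast
  then have "t1 + t2 + bits m + bits n + 1 \<le> (c1 + c2 + 1) * (2 * N + 1)"
    using assms(3,4) by (simp add: algebra_simps)
  then show "ev N P env (Add e1 e2) (Num (m + n)) (c1 + c2 + 1)"
      "ev N P env (Sub e1 e2) (Num (m - n)) (c1 + c2 + 1)"
      "ev N P env (Less e1 e2) (Num (if m < n then 1 else 0)) (c1 + c2 + 1)"
    unfolding ev_def using eval_evals.Add[OF t(1,3)] eval_evals.Sub[OF t(1,3)] eval_evals.Less[OF t(1,3)]
    by blast+
qed

lemma ev_MkNode: "ev N P env e1 v1 c1 \<Longrightarrow> ev N P env e2 v2 c2 \<Longrightarrow> ev N P env (MkNode e1 e2) (Node v1 v2) (c1 + c2 + 1)"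
  unfolding ev_def by (elim exE conjE, rule exI, rule conjI, erule eval_evals.MkNode, assumption) (simp add: algebra_simps)

lemma ev_Left: "ev N P env e (Node v1 v2) c \<Longrightarrow> ev N P env (Left e) v1 (c + 1)"
  unfolding ev_def by (elim exE conjE, rule exI, rule conjI, erule eval_evals.Left) (simp add: algebra_simps)

lemma ev_Right: "ev N P env e (Node v1 v2) c \<Longrightarrow> ev N P env (Right e) v2 (c + 1)"
  unfolding ev_def by (elim exE conjE, rule exI, rule conjI, erule eval_evals.Right) (simp add: algebra_simps)

lemma ev_IsNode_Num: "ev N P env e (Num n) c \<Longrightarrow> ev N P env (IsNode e) (Num 0) (c + 1)"
  unfolding ev_def by (elim exE conjE, rule exI, rule conjI, erule eval_evals.IsNode_Num) (simp add: algebra_simps)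

lemma ev_IsNode_Node: "ev N P env e (Node v1 v2) c \<Longrightarrow> ev N P env (IsNode e) (Num 1) (c + 1)"
  unfolding ev_def by (elim exE conjE, rule exI, rule conjI, erule eval_evals.IsNode_Node) (simp add: algebra_simps)

text \<open>Value and count stay conditional on \<open>n\<close>, so a run need not be split into
  cases at each comparison; the simplifier matches the conditionals with those of the computed
  function at the end.\<close>

lemma ev_IfNz:
  assumes "ev N P env e (Num n) c" "n \<noteq> 0 \<Longrightarrow> ev N P env e1 v1 c1" "n = 0 \<Longrightarrow> ev N P env e2 v2 c2"
  shows "ev N P env (IfNz e e1 e2) (if n \<noteq> 0 then v1 else v2) (c + (if n \<noteq> 0 then c1 else c2) + 1)"
proof -
  obtain t where t: "eval P env e (Num n) t" "t \<le> c * (2 * N + 1)" using assms(1) unfolding ev_def by blast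
  show ?thesis
  proof (cases "n = 0")
    case True
    then obtain t2 where "eval P env e2 v2 t2" "t2 \<le> c2 * (2 * N + 1)" using assms(3) unfolding ev_def by blast
    then show ?thesis using eval_evals.IfNz_zero[of P env e t e2 v2 t2] t True unfolding ev_def
      by (intro exI[of _ "t + t2 + 1"]) (auto simp: algebra_simps)
  next
    case False
    then obtain t2 where "eval P env e1 v1 t2" "t2 \<le> c1 * (2 * N + 1)" using assms(2) unfolding ev_def by blast
    then show ?thesis using eval_evals.IfNz_nonzero[of P env e n t e1 v1 t2] t False unfolding ev_def
      by (intro exI[of _ "t + t2 + 1"]) (auto simp: algebra_simps)
  qed
qed

text \<open>
  The following rules have to be tried before \<open>ev_IfNz\<close>, which asks for the evaluation of both branches:
  on a leaf, the branch for a nonempty list is stuck. Every list function tests its list in \<open>Var 0\<close>.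
\<close>

lemma ev_If_Node: "ev N P (Node a b # env) e1 v c \<Longrightarrow> ev N P (Node a b # env) (IfNz (IsNode (Var 0)) e1 e2) v (c + 3)"
  by (rule ev_mono[OF ev_IfNz[OF ev_IsNode_Node[OF ev_Vars(1)]]]) auto

lemma ev_If_Num: "ev N P (Num n # env) e2 v c \<Longrightarrow> ev N P (Num n # env) (IfNz (IsNode (Var 0)) e1 e2) v (c + 3)"
  by (rule ev_mono[OF ev_IfNz[OF ev_IsNode_Num[OF ev_Vars(1)]]]) auto

lemma ev_If_Node1:
  "ev N P (x # Node a b # env) e1 v c \<Longrightarrow> ev N P (x # Node a b # env) (IfNz (IsNode (Var 1)) e1 e2) v (c + 3)"
  by (rule ev_mono[OF ev_IfNz[OF ev_IsNode_Node[OF ev_Vars(2)]]]) auto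

lemma ev_If_Num1:
  "ev N P (x # Num n # env) e2 v c \<Longrightarrow> ev N P (x # Num n # env) (IfNz (IsNode (Var 1)) e1 e2) v (c + 3)"
  by (rule ev_mono[OF ev_IfNz[OF ev_IsNode_Num[OF ev_Vars(2)]]]) auto

lemma ev_LetIn: "ev N P env e1 v1 c1 \<Longrightarrow> ev N P (v1 # env) e2 v2 c2 \<Longrightarrow> ev N P env (LetIn e1 e2) v2 (c1 + c2 + 1)"
  unfolding ev_def by (elim exE conjE, rule exI, rule conjI, erule eval_evals.LetIn, assumption) (simp add: algebra_simps)

lemma ev_Call: "evs N P env es vs c1 \<Longrightarrow> calls N P f vs v c2 \<Longrightarrow> ev N P env (Call f es) v (c1 + c2 + 1)"
  unfolding ev_def evs_def calls_def by (elim exE conjE, rule exI, rule conjI, erule eval_evals.Call, assumption, assumption) (simp add: algebra_simps)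

lemma evs_Nil: "evs N P env [] [] 0"
  unfolding evs_def by (auto intro: eval_evals.intros)

lemma evs_Cons: "ev N P env e v c1 \<Longrightarrow> evs N P env es vs c2 \<Longrightarrow> evs N P env (e # es) (v # vs) (c1 + c2)"
  unfolding ev_def evs_def by (elim exE conjE, rule exI, rule conjI, erule eval_evals.evals_Cons, assumption) (simp add: algebra_simps)

lemmas ev_rules = ev_Vars ev_If_Node ev_If_Num ev_If_Node1 ev_If_Num1 ev_Const ev_Add ev_Sub ev_Less
  ev_MkNode ev_Left ev_Right ev_IfNz ev_LetIn ev_Call evs_Nil evs_Cons

lemma callsI: "f < length P \<Longrightarrow> P ! f = e \<Longrightarrow> ev N P vs e v c \<Longrightarrow> v = v' \<Longrightarrow> c \<le> c' \<Longrightarrow> calls N P f vs v' c'"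
  unfolding calls_def by (blast intro: ev_mono)

section \<open>The programs\<close>

text \<open>
  Function 0 is the main function, and the other indices are the positions in the list \<open>common\<close> below,
  counted from 1.
\<close>

definition eq_body :: expr where
  "eq_body = IfNz (Less (Var 0) (Var 1)) (Const 0) (IfNz (Less (Var 1) (Var 0)) (Const 0) (Const 1))"

abbreviation "Eq e e' \<equiv> Call 1 [e, e']"

abbreviation "cl_u e \<equiv> Left (Left e)"
abbreviation "cl_a e \<equiv> Right (Left e)"
abbreviation "cl_x e \<equiv> Left (Right e)"
abbreviation "cl_b e \<equiv> Right (Right e)"

text \<open>The recursive call is bound once and shared by all branches; a copy in each test would
  be evaluated anew. Below both binders \<open>Var 0\<close> is the first clause,
  \<open>Var 1\<close> the result for the tail, and the arguments start at
  \<open>Var 2\<close>.\<close>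

definition assign_body :: expr where
  "assign_body =
    IfNz (IsNode (Var 0))
      (LetIn (Call 2 [Right (Var 0), Var 1, Var 2])
        (LetIn (Left (Var 1))
          (IfNz (Eq (cl_u (Var 0)) (Var 3))
            (Var 1)
            (IfNz (Eq (cl_x (Var 0)) (Var 3))
              (IfNz (Less (Var 4) (cl_b (Var 0)))
                (MkNode (MkNode (Left (Var 0)) (Left (Var 0))) (Var 1))
                (Var 1))
              (MkNode (Var 0) (Var 1))))))
      (Const 0)"

definition add_body :: expr where
  "add_body =
    IfNz (IsNode (Var 0))
      (MkNode (Add (Left (Var 0)) (Var 2)) (MkNode (MkNode (Var 1) (Var 2)) (Right (Var 0))))
      (Const 0)"

definition better_body :: expr where
  "better_body =
    IfNz (IsNode (Var 0))
      (IfNz (IsNode (Var 1)) (IfNz (Less (Left (Var 0)) (Left (Var 1))) (Var 0) (Var 1)) (Var 0))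
      (Var 1)"

definition maxw_body :: expr where
  "maxw_body =
    IfNz (IsNode (Var 0))
      (LetIn (Call 5 [Right (Var 0), Var 1])
        (IfNz (Eq (cl_u (Left (Var 1))) (Var 2))
          (IfNz (Less (Var 0) (cl_a (Left (Var 1)))) (cl_a (Left (Var 1))) (Var 0))
          (Var 0)))
      (Const 0)"

text \<open>Programs are first-order, so the functional argument of \<open>set_max\<close> becomes a
  fixed call of function 11, \<open>solve_pvc\<close>, and its budget becomes an argument.\<close>

definition set_max_body :: expr where
  "set_max_body =
    LetIn (Call 5 [Var 0, Var 1])
      (Call 3 [Call 11 [Call 2 [Var 1, Var 2, Var 0], Var 3], Var 2, Var 0])"

definition partner_body :: expr where
  "partner_body =
    IfNz (IsNode (Var 0))
      (LetIn (Call 7 [Right (Var 0), Var 1, Var 2, Var 3])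
        (LetIn (Left (Var 1))
          (IfNz (Eq (cl_u (Var 0)) (Var 3))
            (IfNz (Eq (cl_x (Var 0)) (Var 5))
              (Var 1)
              (IfNz (Less (cl_a (Var 0)) (Var 4)) (Var 1) (MkNode (cl_x (Var 0)) (Const 0))))
            (Var 1))))
      (Const 0)"

abbreviation "heavy_node d y \<equiv> MkNode (MkNode (cl_a d) (cl_u d)) (MkNode (cl_x d) y)"

definition heavier_body :: expr where
  "heavier_body =
    IfNz (IsNode (Var 0))
      (IfNz (IsNode (Var 1))
        (IfNz (Less (cl_u (Var 1)) (cl_a (Var 2))) (heavy_node (Var 2) (Left (Var 0))) (Var 1))
        (heavy_node (Var 2) (Left (Var 0))))
      (Var 1)"

definition heavy_body :: expr where
  "heavy_body =
    IfNz (IsNode (Var 0))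
      (LetIn (Left (Var 0))
        (Call 8 [Call 7 [Var 2, cl_u (Var 0), cl_a (Var 0), cl_x (Var 0)],
          Call 9 [Right (Var 1), Var 2], Var 0]))
      (Const 0)"

text \<open>The budget in \<open>Var 2\<close> is already decremented. The outer
  \<open>set_max\<close> of the second branch is inlined, because function 6 always continues with
  \<open>solve_pvc\<close>. On a value of \<open>heavy\<close>, the selectors \<open>cl_a\<close>,
  \<open>cl_x\<close> and \<open>cl_b\<close> yield \<open>u\<close>, \<open>x\<close> and
  \<open>y\<close>.\<close>

definition branch_pvc_body :: expr where
  "branch_pvc_body =
    IfNz (IsNode (Var 0))
      (Call 4 [Call 6 [Var 1, cl_a (Var 0), Var 2],
        LetIn (Call 5 [Var 1, cl_x (Var 0)])
          (Call 3 [Call 6 [Call 2 [Var 2, cl_x (Var 1), Var 0], cl_b (Var 1), Sub (Var 3) (Const 1)],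
            cl_x (Var 1), Var 0])])
      (Call 6 [Var 1, cl_u (Left (Var 1)), Var 2])"

definition solve_pvc_body :: expr where
  "solve_pvc_body =
    IfNz (IsNode (Var 0))
      (IfNz (Var 1) (Call 10 [Call 9 [Var 0, Var 0], Var 0, Sub (Var 1) (Const 1)]) (Const 0))
      (MkNode (Const 0) (Const 0))"

section \<open>Code of the search for DPVC\<close>

definition member_body :: expr where
  "member_body =
    IfNz (IsNode (Var 0))
      (IfNz (Eq (Left (Var 0)) (Var 1)) (Const 1) (Call 12 [Right (Var 0), Var 1]))
      (Const 0)"

definition weights_body :: expr where
  "weights_body =
    IfNz (IsNode (Var 0))
      (LetIn (Call 13 [Right (Var 0), Var 1])
        (IfNz (Eq (cl_u (Left (Var 1))) (Var 2))
          (IfNz (Call 12 [Var 0, cl_a (Left (Var 1))]) (Var 0) (MkNode (cl_a (Left (Var 1))) (Var 0)))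
          (Var 0)))
      (Const 0)"

definition loopw_body :: expr where
  "loopw_body =
    IfNz (IsNode (Var 0))
      (LetIn (Call 14 [Right (Var 0), Var 1])
        (IfNz (Eq (cl_u (Left (Var 1))) (Var 2))
          (IfNz (Eq (cl_x (Left (Var 1))) (Var 2))
            (IfNz (Less (Var 0) (cl_a (Left (Var 1)))) (cl_a (Left (Var 1))) (Var 0))
            (Var 0))
          (Var 0)))
      (Const 0)"

definition count_gt_body :: expr where
  "count_gt_body =
    IfNz (IsNode (Var 0))
      (LetIn (Call 15 [Right (Var 0), Var 1])
        (IfNz (Less (Var 2) (Left (Var 1))) (Add (Const 1) (Var 0)) (Var 0)))
      (Const 0)"

definition try_all_body :: expr where
  "try_all_body =
    IfNz (IsNode (Var 0))
      (LetIn (Call 16 [Right (Var 0), Var 1, Var 2, Var 3, Var 4, Var 5])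
        (LetIn (Left (Var 1))
          (IfNz (Less (Var 0) (Var 4))
            (Var 1)
            (IfNz (Less (Call 15 [Var 3, Var 0]) (Var 7))
              (Call 4 [Call 3 [Call 18 [Call 2 [Var 5, Var 6, Var 0], Sub (Var 7) (Const 1)], Var 6, Var 0], Var 1])
              (Var 1)))))
      (Const 0)"

definition branch_dpvc_body :: expr where
  "branch_dpvc_body =
    LetIn (Call 13 [Var 0, Var 1])
      (Call 16 [Var 0, Var 0, Call 14 [Var 1, Var 2], Var 1, Var 2, Var 3])"

definition solve_dpvc_body :: expr where
  "solve_dpvc_body =
    IfNz (IsNode (Var 0))
      (IfNz (Var 1)
        (Call 4 [Call 17 [Var 0, cl_u (Left (Var 0)), Var 1], Call 17 [Var 0, cl_x (Left (Var 0)), Var 1]])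
        (Const 0))
      (MkNode (Const 0) (Const 0))"

section \<open>Code for reading the input and writing the output\<close>

definition arc_weight_body :: expr where
  "arc_weight_body =
    IfNz (IsNode (Var 0))
      (IfNz (Eq (Left (Left (Left (Var 0)))) (Var 1))
        (IfNz (Eq (Right (Left (Left (Var 0)))) (Var 2))
          (Right (Left (Var 0)))
          (Call 19 [Right (Var 0), Var 1, Var 2]))
        (Call 19 [Right (Var 0), Var 1, Var 2]))
      (Const 0)"

text \<open>An arc carries only its own weight; that of the opposite arc is looked up in the second
  argument, which stays the full list of arcs.\<close>

definition clauses_body :: expr where
  "clauses_body =
    IfNz (IsNode (Var 0))
      (LetIn (Left (Var 0))
        (MkNode
          (MkNode (MkNode (Left (Left (Var 0))) (Right (Var 0)))
            (MkNode (Right (Left (Var 0))) (Call 19 [Var 2, Right (Left (Var 0)), Left (Left (Var 0))])))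
          (Call 20 [Right (Var 1), Var 2])))
      (Const 0)"

definition lookup_body :: expr where
  "lookup_body =
    IfNz (IsNode (Var 0))
      (IfNz (Eq (Left (Left (Var 0))) (Var 1)) (Right (Left (Var 0))) (Call 21 [Right (Var 0), Var 1]))
      (Const 0)"

definition output_body :: expr where
  "output_body =
    IfNz (IsNode (Var 0))
      (MkNode (Call 21 [Var 1, Left (Var 0)]) (Call 22 [Right (Var 0), Var 1]))
      (Const 0)"

definition finish_body :: expr where
  "finish_body = IfNz (IsNode (Var 0)) (Call 22 [Var 1, Right (Var 0)]) (Const 0)"

definition common :: program where
  "common =
    [eq_body, assign_body, add_body, better_body, maxw_body, set_max_body, partner_body,
     heavier_body, heavy_body, branch_pvc_body, solve_pvc_body, member_body, weights_body,
     loopw_body, count_gt_body, try_all_body, branch_dpvc_body, solve_dpvc_body, arc_weight_body,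
     clauses_body, lookup_body, output_body, finish_body]"

definition main_body :: "nat \<Rightarrow> expr" where
  "main_body f =
    Call 23 [Call f [Call 20 [Left (Right (Var 0)), Left (Right (Var 0))], Right (Right (Var 0))],
      Left (Var 0)]"

section \<open>Encodings of the data as trees\<close>

fun enc_clause :: "clause \<Rightarrow> val" where
  "enc_clause (u, a, x, b) = Node (Node (Num u) (Num a)) (Node (Num x) (Num b))"

abbreviation "enc C \<equiv> encode_list (map enc_clause C)"

abbreviation "enc_nums L \<equiv> encode_list (map Num L)"

fun enc_pair :: "nat \<times> nat \<Rightarrow> val" where
  "enc_pair (v, c) = Node (Num v) (Num c)"

fun enc_result :: "result \<Rightarrow> val" where
  "enc_result None = Num 0"
| "enc_result (Some (s, L)) = Node (Num s) (encode_list (map enc_pair L))"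

text \<open>The dummy leaf makes a found vertex an inner node, which \<open>IsNode\<close> can tell
  from failure.\<close>

fun enc_partner :: "nat option \<Rightarrow> val" where
  "enc_partner None = Num 0"
| "enc_partner (Some y) = Node (Num y) (Num 0)"

fun enc_heavy :: "clause option \<Rightarrow> val" where
  "enc_heavy None = Num 0"
| "enc_heavy (Some h) = enc_clause h"

fun enc_arc :: "(nat \<times> nat \<Rightarrow> nat) \<Rightarrow> nat \<times> nat \<Rightarrow> val" where
  "enc_arc w (u, v) = Node (Node (Num u) (Num v)) (Num (w (u, v)))"

definition clauses :: "(nat \<times> nat \<Rightarrow> nat) \<Rightarrow> (nat \<times> nat) list \<Rightarrow> clause list" where
  "clauses w = map (\<lambda>(u, v). (u, w (u, v), v, w (v, u)))"

section \<open>Bounds on the numbers that occur\<close>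

lemma maxw_le: "bnd A C \<Longrightarrow> maxw v C \<le> A"
  using maxw_in[of v C] unfolding bnd_def by (cases "maxw v C = 0") auto

lemma loopw_bnd: "bnd A C \<Longrightarrow> loopw v C \<le> A"
  by (auto simp: loopw_le_iff bnd_def)

lemma length_weights: "length (weights v C) \<le> length C"
  by (induction v C rule: weights.induct) (auto simp: List.insert_def intro: le_SucI)

lemma heavy_bnd: "bnd A D \<Longrightarrow> bnd A C \<Longrightarrow> heavy D C = Some h \<Longrightarrow> bnd A [h]"
proof -
  assume *: "bnd A D" "bnd A C" "heavy D C = Some h"
  obtain a u x y where h: "h = (a, u, x, y)" by (cases h)
  obtain b a' b' where "(u, a, x, b) \<in> set D" "(u, a', y, b') \<in> set C"
    using heavy_Some[OF *(3)[unfolded h]] partner_Some by blast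
  then show ?thesis using *(1,2) unfolding bnd_def h by fastforce
qed

text \<open>Costs are operands of additions and comparisons, so their bits have to be bounded as
  well.\<close>

definition small :: "nat \<Rightarrow> result \<Rightarrow> bool" where
  "small A r \<longleftrightarrow> (\<forall>s L. r = Some (s, L) \<longrightarrow> s \<le> A)"

lemma small_simps [simp]: "small A None" "small A (Some p) \<longleftrightarrow> fst p \<le> A"
  by (cases p; auto simp: small_def)+

lemma small_mono: "small A r \<Longrightarrow> A \<le> A' \<Longrightarrow> small A' r"
  by (cases r) auto

lemma small_better: "small A r1 \<Longrightarrow> small A r2 \<Longrightarrow> small A (better r1 r2)"
  unfolding small_def by (meson better_cases)

text \<open>Fixing a vertex that occurs removes at least one clause and costs at most
  \<open>B\<close>; so \<open>B\<close> per clause bounds the total.\<close>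

lemma small_add:
  assumes "small (length (assign v c C) * B) r" "(v, c, x, b) \<in> set C" "c \<le> B"
  shows "small (length C * B) (add v c r)"
proof -
  have "Suc (length (assign v c C)) * B \<le> length C * B"
    using length_assign_less[OF assms(2), of c] by (intro mult_le_mono1) simp
  then show ?thesis using assms(1,3) by (auto simp: add_def map_option_case split: option.split)
qed

lemma small_set_max:
  assumes "small (length (assign v (maxw v C) C) * B) (f (assign v (maxw v C) C))" "bnd B C"
  shows "small (length C * B) (set_max f v C)"
proof (cases "maxw v C = 0")
  case True
  \<comment> \<open>With maximum 0 possibly no clause disappears, but nothing is added to the cost
    either.\<close>
  have "small (length C * B) (f (assign v (maxw v C) C))"
    by (rule small_mono[OF assms(1)]) (intro mult_le_mono1 length_assign_le)
  then show ?thesis using True by (auto simp: set_max_def add_def map_option_case split: option.split)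
next
  case False
  then show ?thesis
    unfolding set_max_def using maxw_in[of v C] assms maxw_le by (auto intro!: small_add)
qed

lemma small_branch_pvc:
  assumes "\<And>C. bnd B C \<Longrightarrow> small (length C * B) (f C)" "\<And>C. bnd B C \<Longrightarrow> small (length C * B) (g C)" "bnd B C"
  shows "small (length C * B) (branch_pvc f g C)"
proof -
  have "small (length C * B) (set_max f v C)" for v
    using assms by (intro small_set_max assms bnd_assign)
  moreover have "small (length C * B) (set_max (set_max g y) x C)" for x y
    using assms by (intro small_set_max assms bnd_assign)
  ultimately show ?thesis
    unfolding branch_pvc_def list.case_eq_if option.case_eq_if prod.case_eq_if by (simp add: small_better)
qed

lemma small_solve_pvc: "bnd B C \<Longrightarrow> small (length C * B) (solve_pvc k C)"
  by (induction k arbitrary: C rule: solve_pvc.induct) (auto intro: small_branch_pvc)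

lemma small_branch_dpvc:
  assumes "\<And>c. small (length (assign v c C) * B) (f (assign v c C))" "bnd B C"
  shows "small (length C * B) (branch_dpvc f k v C)"
  unfolding small_def
proof (intro allI impI)
  fix s L assume "branch_dpvc f k v C = Some (s, L)"
  then obtain c where c: "c \<in> set (weights v C)" "add v c (f (assign v c C)) = Some (s, L)"
    using try_all_cases unfolding branch_dpvc_def by blast
  then obtain x b where "(v, c, x, b) \<in> set C" by (auto simp: set_weights)
  then have "small (length C * B) (add v c (f (assign v c C)))"
    using assms by (intro small_add) (auto simp: bnd_def)
  then show "s \<le> length C * B" using c(2) by simp
qed

lemma small_solve_dpvc: "bnd B C \<Longrightarrow> small (length C * B) (solve_dpvc k C)"
proof (induction k arbitrary: C)
  case (Suc k)
  have "small (length C * B) (branch_dpvc (solve_dpvc k) (Suc k) v C)" for v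
    using Suc by (intro small_branch_dpvc Suc.IH bnd_assign)
  then show ?case
    by (simp add: small_better list.case_eq_if prod.case_eq_if)
qed auto

fun pvc_nodes :: "nat \<Rightarrow> nat" where
  "pvc_nodes 0 = 1"
| "pvc_nodes (Suc k) = 1 + pvc_nodes k + pvc_nodes (k - 1)"

fun dpvc_nodes :: "nat \<Rightarrow> nat" where
  "dpvc_nodes 0 = 1"
| "dpvc_nodes (Suc k) = 1 + 2 * Suc k * dpvc_nodes k"

lemma calls_mono: "calls N P f vs v c \<Longrightarrow> c \<le> c' \<Longrightarrow> calls N P f vs v c'"
  unfolding calls_def by (blast intro: ev_mono)

section \<open>Cost of the programs\<close>

text \<open>The main function is a parameter, as both problems share all other code.
  \<open>A\<close> bounds the operands of arithmetic and \<open>N\<close> their bits.\<close>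

locale machine =
  fixes P :: program and N A :: nat and main :: expr
  assumes P: "P = main # common"
    and bits_le: "m \<le> A \<Longrightarrow> bits m \<le> N"
    and A_pos: "1 \<le> A"
begin

lemma bits_1: "bits 1 \<le> N"
  using bits_le A_pos by blast

lemma length_P: "length P = 24"
  by (simp add: P common_def)

lemma code:
  "P ! 1 = eq_body" "P ! 2 = assign_body" "P ! 3 = add_body" "P ! 4 = better_body" "P ! 5 = maxw_body"
  "P ! 6 = set_max_body" "P ! 7 = partner_body" "P ! 8 = heavier_body" "P ! 9 = heavy_body"
  "P ! 10 = branch_pvc_body" "P ! 11 = solve_pvc_body" "P ! 12 = member_body" "P ! 13 = weights_body"
  "P ! 14 = loopw_body" "P ! 15 = count_gt_body" "P ! 16 = try_all_body" "P ! 17 = branch_dpvc_body"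
  "P ! 18 = solve_dpvc_body" "P ! 19 = arc_weight_body" "P ! 20 = clauses_body" "P ! 21 = lookup_body"
  "P ! 22 = output_body" "P ! 23 = finish_body"
  by (simp_all add: P common_def)

text \<open>This is the pattern of all cost lemmas: the rules run the body symbolically, the
  simplifier discharges the bounds on bits, and finally value and count are compared with the claim,
  whose constants are generous.\<close>

lemma calls_eq: "m \<le> A \<Longrightarrow> n \<le> A \<Longrightarrow> calls N P 1 [Num m, Num n] (Num (if m = n then 1 else 0)) 9"
  by (rule callsI[OF _ code(1)[unfolded eq_body_def]], simp add: length_P,
     (rule ev_rules | (simp add: bits_le; fail))+)

lemma calls_assign:
  "v \<le> A \<Longrightarrow> c \<le> A \<Longrightarrow> bnd A C \<Longrightarrow> calls N P 2 [enc C, Num v, Num c] (enc (assign v c C)) (80 * length C + 10)"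
proof (induction C)
  case Nil
  show ?case
    unfolding list.map encode_list.simps
    by (rule callsI[OF _ code(2)[unfolded assign_body_def]], simp add: length_P,
       (rule ev_rules | (simp add: bits_le; fail))+)
next
  case (Cons d C)
  obtain u a x b where d: "d = (u, a, x, b)" by (cases d)
  have *: "bnd A C" "u \<le> A" "a \<le> A" "x \<le> A" "b \<le> A"
    using Cons.prems unfolding bnd_def d by (metis list.set_intros)+
  show ?case
    unfolding list.map encode_list.simps d enc_clause.simps
    by (rule callsI[OF _ code(2)[unfolded assign_body_def]], simp add: length_P,
       (rule ev_rules calls_eq Cons.IH | (simp add: bits_le * Cons.prems; fail))+)
qed

lemma calls_add:
  assumes "small A r" "v \<le> A" "c \<le> A"
  shows "calls N P 3 [enc_result r, Num v, Num c] (enc_result (add v c r)) 30"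
proof (cases r)
  case None
  show ?thesis
    unfolding None enc_result.simps
    by (rule callsI[OF _ code(3)[unfolded add_body_def]], simp add: length_P,
       (rule ev_rules | (simp add: bits_le add_def; fail))+)
next
  case (Some p)
  obtain s L where p: "p = (s, L)" by (cases p)
  have *: "s \<le> A" using assms(1) Some p by (simp add: small_def)
  show ?thesis
    unfolding Some p enc_result.simps
    by (rule callsI[OF _ code(3)[unfolded add_body_def]], simp add: length_P,
       (rule ev_rules | (simp add: bits_le assms * add_def; fail))+)
qed

lemma calls_better:
  assumes "small A r1" "small A r2"
  shows "calls N P 4 [enc_result r1, enc_result r2] (enc_result (better r1 r2)) 30"
proof (cases "(r1, r2)" rule: better.cases)
  case (1 r)
  then have "r1 = None" by simp
  show ?thesis
    unfolding \<open>r1 = None\<close> enc_result.simps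
    by (rule callsI[OF _ code(4)[unfolded better_body_def]], simp add: length_P,
       (rule ev_rules | (simp add: bits_le; fail))+)
next
  case (2 p)
  obtain s L where "p = (s, L)" by (cases p)
  then have *: "r1 = Some (s, L)" "r2 = None" using 2 by auto
  show ?thesis
    unfolding * enc_result.simps
    by (rule callsI[OF _ code(4)[unfolded better_body_def]], simp add: length_P,
       (rule ev_rules | (simp add: bits_le; fail))+)
next
  case (3 p q)
  obtain s L s' L' where "p = (s, L)" "q = (s', L')" by (cases p, cases q)
  then have *: "r1 = Some (s, L)" "r2 = Some (s', L')" using 3 by auto
  then have **: "s \<le> A" "s' \<le> A" using assms by (auto simp: small_def)
  show ?thesis
    unfolding * enc_result.simps
    by (rule callsI[OF _ code(4)[unfolded better_body_def]], simp add: length_P,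
       (rule ev_rules | (simp add: bits_le **; fail))+)
qed

lemma calls_maxw: "v \<le> A \<Longrightarrow> bnd A C \<Longrightarrow> calls N P 5 [enc C, Num v] (Num (maxw v C)) (60 * length C + 10)"
proof (induction C)
  case Nil
  show ?case
    unfolding list.map encode_list.simps
    by (rule callsI[OF _ code(5)[unfolded maxw_body_def]], simp add: length_P,
       (rule ev_rules | (simp add: bits_le; fail))+)
next
  case (Cons d C)
  obtain u a x b where d: "d = (u, a, x, b)" by (cases d)
  have *: "bnd A C" "u \<le> A" "a \<le> A" "x \<le> A" "b \<le> A"
    using Cons.prems unfolding bnd_def d by (metis list.set_intros)+
  show ?case
    unfolding list.map encode_list.simps d enc_clause.simps
    by (rule callsI[OF _ code(5)[unfolded maxw_body_def]], simp add: length_P,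
       (rule ev_rules calls_eq Cons.IH | (simp add: bits_le * Cons.prems maxw_le max_def; fail))+)
qed

lemma calls_partner:
  "u0 \<le> A \<Longrightarrow> a0 \<le> A \<Longrightarrow> x0 \<le> A \<Longrightarrow> bnd A C \<Longrightarrow>
    calls N P 7 [enc C, Num u0, Num a0, Num x0] (enc_partner (partner u0 a0 x0 C)) (80 * length C + 10)"
proof (induction C)
  case Nil
  show ?case
    unfolding list.map encode_list.simps partner.simps enc_partner.simps
    by (rule callsI[OF _ code(7)[unfolded partner_body_def]], simp add: length_P,
       (rule ev_rules | (simp add: bits_le; fail))+)
next
  case (Cons d C)
  obtain u a x b where d: "d = (u, a, x, b)" by (cases d)
  have *: "bnd A C" "u \<le> A" "a \<le> A" "x \<le> A" "b \<le> A"
    using Cons.prems unfolding bnd_def d by (metis list.set_intros)+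
  show ?case
    unfolding list.map encode_list.simps d enc_clause.simps
    by (rule callsI[OF _ code(7)[unfolded partner_body_def]], simp add: length_P,
       (rule ev_rules calls_eq Cons.IH | (simp add: bits_le * Cons.prems ; fail))+)
qed

lemma calls_heavier:
  assumes "bnd A [d]" "\<And>h. r = Some h \<Longrightarrow> bnd A [h]"
  shows "calls N P 8 [enc_partner p, enc_heavy r, enc_clause d] (enc_heavy (heavier d p r)) 50"
proof (cases "(d, p, r)" rule: heavier.cases)
  case (1 d r)
  then have *: "p = None" by simp
  show ?thesis
    unfolding * enc_partner.simps
    by (rule callsI[OF _ code(8)[unfolded heavier_body_def]], simp add: length_P,
       (rule ev_rules | (simp add: bits_le; fail))+)
next
  case (2 u a x b y)
  then have *: "d = (u, a, x, b)" "p = Some y" "r = None" by auto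
  show ?thesis
    unfolding * enc_partner.simps enc_heavy.simps enc_clause.simps
    by (rule callsI[OF _ code(8)[unfolded heavier_body_def]], simp add: length_P,
       (rule ev_rules | (simp add: bits_le; fail))+)
next
  case (3 u a x b y a' h)
  obtain u' x' y' where "h = (u', x', y')" by (cases h)
  then have *: "d = (u, a, x, b)" "p = Some y" "r = Some (a', u', x', y')" using 3 by auto
  then have **: "a \<le> A" "a' \<le> A" using assms by (auto simp: bnd_def)
  show ?thesis
    unfolding * enc_partner.simps enc_heavy.simps enc_clause.simps
    by (rule callsI[OF _ code(8)[unfolded heavier_body_def]], simp add: length_P,
       (rule ev_rules | (simp add: bits_le **; fail))+)
qed

lemma calls_heavy:
  assumes "bnd A C"
  shows "bnd A D \<Longrightarrow> calls N P 9 [enc D, enc C] (enc_heavy (heavy D C)) (length D * (80 * length C + 120) + 10)"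
proof (induction D)
  case Nil
  show ?case
    unfolding list.map encode_list.simps
    by (rule callsI[OF _ code(9)[unfolded heavy_body_def]], simp add: length_P,
       (rule ev_rules | (simp add: bits_le; fail))+)
next
  case (Cons d D)
  obtain u a x b where d: "d = (u, a, x, b)" by (cases d)
  have *: "bnd A D" "u \<le> A" "a \<le> A" "x \<le> A" "b \<le> A"
    using Cons.prems unfolding bnd_def d by (metis list.set_intros)+
  have **: "bnd A [(u, a, x, b)]" "\<And>h. heavy D C = Some h \<Longrightarrow> bnd A [h]"
    using * heavy_bnd[OF *(1) assms] by (auto simp: bnd_def)
  note hv = calls_heavier[OF **, unfolded enc_clause.simps]
  show ?case
    unfolding list.map encode_list.simps d enc_clause.simps
    by (rule callsI[OF _ code(9)[unfolded heavy_body_def]], simp add: length_P,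
       (rule ev_rules hv calls_partner Cons.IH | (simp add: bits_le * assms; fail))+)
qed

lemma calls_member: "a \<le> A \<Longrightarrow> \<forall>b\<in>set L. b \<le> A \<Longrightarrow>
    calls N P 12 [enc_nums L, Num a] (Num (if a \<in> set L then 1 else 0)) (40 * length L + 10)"
proof (induction L)
  case Nil
  show ?case
    unfolding list.map encode_list.simps
    by (rule callsI[OF _ code(12)[unfolded member_body_def]], simp add: length_P,
       (rule ev_rules | (simp add: bits_le; fail))+)
next
  case (Cons b L)
  show ?case
    unfolding list.map encode_list.simps
    by (rule callsI[OF _ code(12)[unfolded member_body_def]], simp add: length_P,
       (rule ev_rules calls_eq Cons.IH | (use Cons.prems in \<open>simp add: bits_le\<close>; fail))+)
qed

text \<open>A fixed bound \<open>m\<close> makes the cost of the membership tests uniform over the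
  induction.\<close>

lemma calls_weights:
  "v \<le> A \<Longrightarrow> bnd A C \<Longrightarrow> length C \<le> m \<Longrightarrow>
    calls N P 13 [enc C, Num v] (enc_nums (weights v C)) (length C * (40 * m + 80) + 10)"
proof (induction C)
  case Nil
  show ?case
    unfolding list.map encode_list.simps
    by (rule callsI[OF _ code(13)[unfolded weights_body_def]], simp add: length_P,
       (rule ev_rules | (simp add: bits_le; fail))+)
next
  case (Cons d C)
  obtain u a x b where d: "d = (u, a, x, b)" by (cases d)
  have *: "bnd A C" "u \<le> A" "a \<le> A" "x \<le> A" "b \<le> A"
    using Cons.prems unfolding bnd_def d by (metis list.set_intros)+
  have "length C \<le> m" using Cons.prems(3) by simp
  have **: "length (weights v C) \<le> m" "\<forall>b\<in>set (weights v C). b \<le> A"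
    using length_weights[of v C] Cons.prems(3) *(1) by (auto simp: set_weights bnd_def)
  then have "40 * length (weights v C) \<le> 40 * m" by simp
  note ** = ** this \<open>length C \<le> m\<close>
  show ?case
    unfolding list.map encode_list.simps d enc_clause.simps
    by (rule callsI[OF _ code(13)[unfolded weights_body_def]], simp add: length_P,
       (rule ev_rules calls_eq calls_member Cons.IH | (simp add: bits_le * Cons.prems ** List.insert_def; fail))+) (use ** in auto)
qed

lemma calls_loopw: "v \<le> A \<Longrightarrow> bnd A C \<Longrightarrow> calls N P 14 [enc C, Num v] (Num (loopw v C)) (80 * length C + 10)"
proof (induction C)
  case Nil
  show ?case
    unfolding list.map encode_list.simps
    by (rule callsI[OF _ code(14)[unfolded loopw_body_def]], simp add: length_P,
       (rule ev_rules | (simp add: bits_le; fail))+)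
next
  case (Cons d C)
  obtain u a x b where d: "d = (u, a, x, b)" by (cases d)
  have *: "bnd A C" "u \<le> A" "a \<le> A" "x \<le> A" "b \<le> A"
    using Cons.prems unfolding bnd_def d by (metis list.set_intros)+
  show ?case
    unfolding list.map encode_list.simps d enc_clause.simps
    by (rule callsI[OF _ code(14)[unfolded loopw_body_def]], simp add: length_P,
       (rule ev_rules calls_eq Cons.IH | (simp add: bits_le * Cons.prems loopw_bnd max_def; fail))+)
qed

lemma calls_count_gt: "a \<le> A \<Longrightarrow> \<forall>b\<in>set L. b \<le> A \<Longrightarrow> length L \<le> A \<Longrightarrow>
    calls N P 15 [enc_nums L, Num a] (Num (count_gt a L)) (40 * length L + 10)"
proof (induction L)
  case Nil
  show ?case
    unfolding list.map encode_list.simps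
    by (rule callsI[OF _ code(15)[unfolded count_gt_body_def]], simp add: length_P,
       (rule ev_rules | (simp add: bits_le; fail))+)
next
  case (Cons b L)
  have "count_gt a L \<le> A" using Cons.prems(3) unfolding count_gt by (auto intro: le_trans[OF length_filter_le])
  note * = Cons.prems A_pos this
  show ?case
    unfolding list.map encode_list.simps
    by (rule callsI[OF _ code(15)[unfolded count_gt_body_def]], simp add: length_P,
       (rule ev_rules Cons.IH | (use * in \<open>simp add: bits_le\<close>; fail))+)
qed

lemma calls_arc_weight: "p \<le> A \<Longrightarrow> q \<le> A \<Longrightarrow> \<forall>(u, v)\<in>set as. u \<le> A \<and> v \<le> A \<Longrightarrow> (p, q) \<in> set as \<Longrightarrow>
    calls N P 19 [encode_list (map (enc_arc w) as), Num p, Num q] (Num (w (p, q))) (60 * length as + 10)"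
proof (induction as)
  case Nil
  then show ?case by simp
next
  case (Cons d as)
  obtain u v where d: "d = (u, v)" by (cases d)
  show ?case
    unfolding list.map encode_list.simps d enc_arc.simps
    by (rule callsI[OF _ code(19)[unfolded arc_weight_body_def]], simp add: length_P,
       (rule ev_rules calls_eq Cons.IH | (use Cons.prems d in \<open>simp add: bits_le split: if_splits\<close>; fail))+)
qed

lemma calls_clauses:
  assumes "\<forall>(u, v)\<in>set as. u \<le> A \<and> v \<le> A"
  shows "\<forall>(u, v)\<in>set as'. (v, u) \<in> set as \<Longrightarrow>
    calls N P 20 [encode_list (map (enc_arc w) as'), encode_list (map (enc_arc w) as)] (enc (clauses w as'))
      (length as' * (60 * length as + 80) + 10)"
proof (induction as')
  case Nil
  show ?case
    unfolding list.map encode_list.simps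
    by (rule callsI[OF _ code(20)[unfolded clauses_body_def]], simp add: length_P,
       (rule ev_rules | (simp add: bits_le clauses_def; fail))+)
next
  case (Cons d as')
  obtain u v where d: "d = (u, v)" by (cases d)
  have *: "(v, u) \<in> set as" "u \<le> A" "v \<le> A" using Cons.prems assms by (auto simp: d)
  show ?case
    unfolding list.map encode_list.simps d enc_arc.simps
    by (rule callsI[OF _ code(20)[unfolded clauses_body_def]], simp add: length_P,
       (rule ev_rules calls_arc_weight Cons.IH | (use Cons.prems * assms in \<open>simp add: bits_le clauses_def\<close>; fail))+)
qed

lemma calls_lookup: "v \<le> A \<Longrightarrow> \<forall>(u, c)\<in>set L. u \<le> A \<Longrightarrow>
    calls N P 21 [encode_list (map enc_pair L), Num v] (Num (lookup L v)) (40 * length L + 10)"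
proof (induction L)
  case Nil
  show ?case
    unfolding list.map encode_list.simps
    by (rule callsI[OF _ code(21)[unfolded lookup_body_def]], simp add: length_P,
       (rule ev_rules | (simp add: bits_le; fail))+)
next
  case (Cons d L)
  obtain u c where d: "d = (u, c)" by (cases d)
  show ?case
    unfolding list.map encode_list.simps d enc_pair.simps
    by (rule callsI[OF _ code(21)[unfolded lookup_body_def]], simp add: length_P,
       (rule ev_rules calls_eq Cons.IH | (use Cons.prems d in \<open>simp add: bits_le\<close>; fail))+)
qed

lemma calls_output: "\<forall>v\<in>set vs. v \<le> A \<Longrightarrow> \<forall>(u, c)\<in>set L. u \<le> A \<Longrightarrow>
    calls N P 22 [enc_nums vs, encode_list (map enc_pair L)] (enc_nums (map (lookup L) vs))
      (length vs * (40 * length L + 40) + 10)"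
proof (induction vs)
  case Nil
  show ?case
    unfolding list.map encode_list.simps
    by (rule callsI[OF _ code(22)[unfolded output_body_def]], simp add: length_P,
       (rule ev_rules | (simp add: bits_le; fail))+)
next
  case (Cons v vs)
  show ?case
    unfolding list.map encode_list.simps
    by (rule callsI[OF _ code(22)[unfolded output_body_def]], simp add: length_P,
       (rule ev_rules calls_lookup Cons.IH | (use Cons.prems in \<open>simp add: bits_le\<close>; fail))+)
qed

section \<open>Steps of the search for PVC\<close>

lemma calls_set_max:
  assumes "v \<le> A" "bnd A C"
    and "calls N P 11 [enc (assign v (maxw v C) C), Num k] (enc_result (f (assign v (maxw v C) C))) X"
    and "small A (f (assign v (maxw v C) C))"
  shows "calls N P 6 [enc C, Num v, Num k] (enc_result (set_max f v C)) (X + 140 * length C + 100)"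
  by (rule callsI[OF _ code(6)[unfolded set_max_body_def]], simp add: length_P,
     (rule ev_rules calls_maxw calls_assign calls_add assms(3) | (simp add: assms maxw_le set_max_def; fail))+)

text \<open>\<open>K\<close> bounds the steps at one node of the search tree, with a quadratic part
  for \<open>heavy\<close>. Assignments never lengthen the list, so \<open>n\<close> bounds its
  length at every node, and \<open>n * B\<close> bounds all costs.\<close>

lemma calls_solve_pvc:
  assumes n: "n * B \<le> A" "B \<le> A" and K: "n * (80 * n + 120) + 1000 * n + 1000 \<le> K"
  shows "bnd B C \<Longrightarrow> length C \<le> n \<Longrightarrow> k \<le> A \<Longrightarrow>
    calls N P 11 [enc C, Num k] (enc_result (solve_pvc k C)) (K * pvc_nodes k)"
proof (induction k arbitrary: C rule: solve_pvc.induct)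
  case 1
  show ?case
  proof (cases C)
    case Nil
    show ?thesis
      unfolding Nil list.map encode_list.simps
      by (rule callsI[OF _ code(11)[unfolded solve_pvc_body_def]], simp add: length_P,
        (rule ev_rules | (simp add: bits_le; fail))+) (use K in auto)
  next
    case (Cons d D)
    show ?thesis
      unfolding Cons list.map encode_list.simps
      by (rule callsI[OF _ code(11)[unfolded solve_pvc_body_def]], simp add: length_P,
        (rule ev_rules | (simp add: bits_le; fail))+) (use K in auto)
  qed
next
  case (2 k)
  show ?case
  proof (cases C)
    case Nil
    show ?thesis
      unfolding Nil list.map encode_list.simps
      by (rule callsI[OF _ code(11)[unfolded solve_pvc_body_def]], simp add: length_P,
        (rule ev_rules | (simp add: bits_le branch_pvc_def; fail))+) (use K in auto)
  next
    case (Cons d D)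
    obtain u a x b where d: "d = (u, a, x, b)" by (cases d)
    define X where "X = K * pvc_nodes k"
    define Y where "Y = K * pvc_nodes (k - 1)"
    have k: "k \<le> A" using "2.prems"(3) by simp
    have sm: "small A (solve_pvc j C)" if "bnd B C" "length C \<le> n" for j C
      using small_solve_pvc[OF that(1)] that(2) n(1) by (meson le_trans mult_le_mono1 small_mono)
    have bndA: "bnd A C" if "bnd B C" for C using that n(2) unfolding bnd_def by fastforce
    have len: "length (assign v c C) \<le> n" if "length C \<le> n" for v c C
      using length_assign_le that le_trans by blast
    have S1: "calls N P 6 [enc C, Num v, Num k] (enc_result (set_max (solve_pvc k) v C)) (X + 140 * n + 100)"
      if "v \<le> A" "bnd B C" "length C \<le> n" for v C
      by (rule calls_mono[OF calls_set_max[where f = "solve_pvc k", OF that(1) bndA[OF that(2)] "2.IH"(1)[folded X_def]]])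
        (use that k in \<open>auto intro: sm bnd_assign len\<close>)
    have S2: "calls N P 6 [enc C, Num v, Num (k - 1)] (enc_result (set_max (solve_pvc (k - 1)) v C)) (Y + 140 * n + 100)"
      if "v \<le> A" "bnd B C" "length C \<le> n" for v C
      by (rule calls_mono[OF calls_set_max[where f = "solve_pvc (k - 1)", OF that(1) bndA[OF that(2)] "2.IH"(2)[folded Y_def]]])
        (use that k in \<open>auto intro: sm bnd_assign len\<close>)
    have vA: "u \<le> A" using bndA[OF "2.prems"(1)] Cons d by (auto simp: bnd_def)
    have br: "calls N P 10 [enc_heavy (heavy C C), enc C, Num (Suc k - 1)]
      (enc_result (branch_pvc (solve_pvc k) (solve_pvc (k - 1)) C)) (X + Y + 500 * n + 500)"
    proof (cases "heavy C C")
      case None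
      note S1' = S1[OF vA "2.prems"(1,2), unfolded Cons d list.map encode_list.simps enc_clause.simps]
      have "set_max (solve_pvc k) u C = branch_pvc (solve_pvc k) (solve_pvc (k - 1)) C"
        unfolding branch_pvc_def None using Cons d by simp
      note val = arg_cong[OF this, of enc_result, unfolded Cons d list.map encode_list.simps enc_clause.simps]
      show ?thesis
        unfolding None enc_heavy.simps diff_Suc_1
        unfolding Cons d list.map encode_list.simps enc_clause.simps
        by (rule callsI[OF _ code(10)[unfolded branch_pvc_body_def]], simp add: length_P,
          (rule ev_rules S1' val | (simp add: bits_le; fail))+)
    next
      case (Some h)
      obtain W v y z where h: "h = (W, v, y, z)" by (cases h)
      have vs: "v \<le> A" "y \<le> A" "z \<le> A"
        using heavy_bnd[OF _ _ Some, of A] bndA[OF "2.prems"(1)] unfolding h by (auto simp: bnd_def)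
      let ?E = "assign y (maxw y C) C"
      have E: "bnd B ?E" "length ?E \<le> n" using "2.prems"(1,2) by (auto intro: bnd_assign len)
      have smE: "small A (set_max (solve_pvc (k - 1)) z ?E)"
        using small_set_max[of z ?E B "solve_pvc (k - 1)"] E n(1)
        by (meson bnd_assign le_trans mult_le_mono1 small_mono small_solve_pvc)
      have smC: "small A (set_max (solve_pvc k) v C)"
        using small_set_max[of v C B "solve_pvc k"] "2.prems"(1,2) n(1)
        by (meson bnd_assign le_trans mult_le_mono1 small_mono small_solve_pvc)
      have smEE: "small A (set_max (set_max (solve_pvc (k - 1)) z) y C)"
        using small_set_max[of y C B "set_max (solve_pvc (k - 1)) z"] small_set_max[of z ?E B "solve_pvc (k - 1)"]
           "2.prems"(1,2) n(1) E
        by (meson bnd_assign le_trans mult_le_mono1 small_mono small_solve_pvc)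
      have val: "better (set_max (solve_pvc k) v C) (add y (maxw y C) (set_max (solve_pvc (k - 1)) z ?E)) =
          branch_pvc (solve_pvc k) (solve_pvc (k - 1)) C"
        unfolding branch_pvc_def Some h using Cons by (simp add: set_max_def[of "set_max _ _"])
      have mx: "maxw y C \<le> A" using maxw_le bndA "2.prems"(1) by blast
      show ?thesis
        unfolding Some h enc_heavy.simps enc_clause.simps diff_Suc_1
        by (rule callsI[OF _ code(10)[unfolded branch_pvc_body_def]], simp add: length_P,
          (rule ev_rules bits_1 calls_better calls_add calls_assign calls_maxw S1 S2
              smC smE smEE[unfolded set_max_def[of "set_max _ _"]] arg_cong[OF val] |
            (simp add: bits_le A_pos vs mx k E "2.prems"(1,2) bndA; fail))+)
          (use "2.prems"(2) in auto)
    qed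
    have "length C * (80 * length C + 120) \<le> n * (80 * n + 120)"
      using "2.prems"(2) by (intro mult_le_mono) auto
    then have hv: "calls N P 9 [enc C, enc C] (enc_heavy (heavy C C)) (n * (80 * n + 120) + 10)"
      using calls_mono[OF calls_heavy[OF bndA bndA]] "2.prems"(1) by simp
    have "K * pvc_nodes (Suc k) = K + X + Y" by (simp add: X_def Y_def algebra_simps)
    note nodes = this
    note unf = Cons d list.map encode_list.simps enc_clause.simps
    show ?thesis
      unfolding nodes unfolding unf
      by (rule callsI[OF _ code(11)[unfolded solve_pvc_body_def]], simp add: length_P,
        (rule ev_rules bits_1 br[unfolded unf] hv[unfolded unf] | (simp add: bits_le "2.prems"(3); fail))+)
        (use K in auto)
  qed
qed

section \<open>Steps of the search for DPVC\<close>

text \<open>Only candidates that pass both tests are charged \<open>X\<close>. Counting them, and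
  not all weights, makes the branching depend on \<open>k\<close> alone.\<close>

lemma calls_try_all:
  assumes "v \<le> A" "bnd A C" "length C \<le> n" "l \<le> A" "k \<le> A" "\<forall>b\<in>set M. b \<le> A" "length M \<le> n" "n \<le> A"
    and f: "\<And>c. c \<in> set M \<Longrightarrow> calls N P 18 [enc (assign v c C), Num (k - 1)] (enc_result (f (assign v c C))) X"
    and sm: "\<And>c. c \<in> set M \<Longrightarrow> small A (f (assign v c C)) \<and> small A (add v c (f (assign v c C)))"
  shows "set L \<subseteq> set M \<Longrightarrow>
    calls N P 16 [enc_nums L, enc_nums M, Num l, enc C, Num v, Num k]
      (enc_result (try_all (\<lambda>c. add v c (f (assign v c C))) L M l k))
      (length L * (120 * n + 300) + length (filter (\<lambda>c. l \<le> c \<and> count_gt c M < k) L) * X + 10)"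
proof (induction L)
  case Nil
  show ?case
    unfolding list.map encode_list.simps
    by (rule callsI[OF _ code(16)[unfolded try_all_body_def]], simp add: length_P,
       (rule ev_rules | (simp add: bits_le; fail))+)
next
  case (Cons c L)
  have *: "c \<le> A" "set L \<subseteq> set M" "c \<in> set M" "length M \<le> A" using Cons.prems assms(6-8) by auto
  have "count_gt c M \<le> A"
    using *(4) unfolding count_gt by (auto intro: le_trans[OF length_filter_le])
  moreover have "small A (try_all (\<lambda>c. add v c (f (assign v c C))) L M l k)"
    using try_all_cases[of "\<lambda>c. add v c (f (assign v c C))"] sm *(2) unfolding small_def by blast
  ultimately have **: "bits (count_gt c M) \<le> N" "small A (try_all (\<lambda>c. add v c (f (assign v c C))) L M l k)"
    using bits_le by blast+
  show ?case
    unfolding list.map encode_list.simps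
    by (rule callsI[OF _ code(16)[unfolded try_all_body_def]], simp add: length_P,
       (rule ev_rules bits_1 calls_better calls_add calls_assign calls_count_gt f Cons.IH
         | (simp add: bits_le assms(1-6) * ** sm; fail))+)
      (use assms(3,7) in \<open>auto simp: algebra_simps\<close>)
qed

text \<open>On a list without repetitions the rank \<open>count_gt c M\<close> determines
  \<open>c\<close>, and only \<open>k\<close> ranks are below \<open>k\<close>.\<close>

lemma length_candidates:
  assumes "distinct M"
  shows "length (filter (\<lambda>c. l \<le> c \<and> count_gt c M < k) M) \<le> k"
proof -
  let ?S = "{c \<in> set M. l \<le> c \<and> count_gt c M < k}"
  have "inj_on (\<lambda>c. count_gt c M) (set M)"
  proof (rule inj_onI)
    have "count_gt c' M < count_gt c M" if "c \<in> set M" "c' \<in> set M" "c < c'" for c c'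
    proof -
      have eq: "count_gt c M = card {b \<in> set M. c < b}" for c
        unfolding count_gt using assms by (metis distinct_card distinct_filter set_filter)
      show ?thesis unfolding eq using that by (intro psubset_card_mono) auto
    qed
    then show "c = c'" if "c \<in> set M" "c' \<in> set M" "count_gt c M = count_gt c' M" for c c'
      using that by (metis less_irrefl linorder_neqE_nat)
  qed
  then have "card ?S \<le> card {..<k}"
    by (intro card_inj_on_le[of "\<lambda>c. count_gt c M"]) (auto intro: inj_on_subset)
  moreover have "length (filter (\<lambda>c. l \<le> c \<and> count_gt c M < k) M) = card ?S"
    using assms by (metis distinct_card distinct_filter set_filter)
  ultimately show ?thesis by simp
qed

lemma calls_branch_dpvc:
  assumes "v \<le> A" "bnd A C" "length C \<le> n" "k \<le> A" "n \<le> A"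
    and f: "\<And>c. c \<in> set (weights v C) \<Longrightarrow>
      calls N P 18 [enc (assign v c C), Num (k - 1)] (enc_result (f (assign v c C))) X"
    and sm: "\<And>c. c \<in> set (weights v C) \<Longrightarrow> small A (f (assign v c C)) \<and> small A (add v c (f (assign v c C)))"
  shows "calls N P 17 [enc C, Num v, Num k] (enc_result (branch_dpvc f k v C))
    (k * X + n * (200 * n + 500) + 100)"
proof -
  let ?W = "weights v C"
  have W: "\<forall>b\<in>set ?W. b \<le> A" "length ?W \<le> n"
    using assms(2,3) length_weights[of v C] by (auto simp: set_weights bnd_def)
  have "length ?W * (120 * n + 300) \<le> n * (120 * n + 300)" using W(2) by (rule mult_le_mono1)
  moreover have "length (filter (\<lambda>c. loopw v C \<le> c \<and> count_gt c ?W < k) ?W) * X \<le> k * X"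
    by (intro mult_le_mono1 length_candidates distinct_weights)
  ultimately have "calls N P 16 [enc_nums ?W, enc_nums ?W, Num (loopw v C), enc C, Num v, Num k]
      (enc_result (branch_dpvc f k v C)) (n * (120 * n + 300) + k * X + 10)"
    unfolding branch_dpvc_def
    using calls_try_all[OF assms(1-3) loopw_bnd[OF assms(2)] assms(4) W assms(5) f sm order_refl]
    by (rule_tac calls_mono) (assumption, linarith)
  note ta = this
  have "length C * (40 * n + 80) \<le> n * (40 * n + 80)" using assms(3) by (rule mult_le_mono1)
  then have wt: "calls N P 13 [enc C, Num v] (enc_nums ?W) (n * (40 * n + 80) + 10)"
    using calls_mono[OF calls_weights[OF assms(1-3)]] by simp
  show ?thesis
    by (rule callsI[OF _ code(17)[unfolded branch_dpvc_body_def]], simp add: length_P,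
       (rule ev_rules wt ta calls_loopw
         | (simp add: assms; fail))+)
      (use assms(3) in \<open>auto simp: algebra_simps\<close>)
qed

lemma calls_solve_dpvc:
  assumes n: "n * B \<le> A" "B \<le> A" "n \<le> A" and K: "2 * n * (200 * n + 500) + 300 \<le> K"
  shows "bnd B C \<Longrightarrow> length C \<le> n \<Longrightarrow> k \<le> A \<Longrightarrow>
    calls N P 18 [enc C, Num k] (enc_result (solve_dpvc k C)) (K * dpvc_nodes k)"
proof (induction k arbitrary: C)
  case 0
  show ?case
  proof (cases C)
    case Nil
    show ?thesis
      unfolding Nil list.map encode_list.simps
      by (rule callsI[OF _ code(18)[unfolded solve_dpvc_body_def]], simp add: length_P,
        (rule ev_rules | (simp add: bits_le; fail))+) (use K in auto)
  next
    case (Cons d D)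
    show ?thesis
      unfolding Cons list.map encode_list.simps
      by (rule callsI[OF _ code(18)[unfolded solve_dpvc_body_def]], simp add: length_P,
        (rule ev_rules | (simp add: bits_le; fail))+) (use K in auto)
  qed
next
  case (Suc k)
  show ?case
  proof (cases C)
    case Nil
    show ?thesis
      unfolding Nil list.map encode_list.simps
      by (rule callsI[OF _ code(18)[unfolded solve_dpvc_body_def]], simp add: length_P,
        (rule ev_rules | (simp add: bits_le; fail))+) (use K in auto)
  next
    case (Cons d D)
    obtain u a x b where d: "d = (u, a, x, b)" by (cases d)
    define X where "X = K * dpvc_nodes k"
    have bndA: "bnd A C" using Suc.prems(1) n(2) unfolding bnd_def by fastforce
    have le: "m * B \<le> A" if "m \<le> n" for m using that n(1) by (meson le_trans mult_le_mono1)
    have asg: "bnd B (assign v c C)" "length (assign v c C) \<le> n" for v c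
      using Suc.prems(1,2) length_assign_le le_trans by (blast intro: bnd_assign)+
    have br: "calls N P 17 [enc C, Num v, Num (Suc k)] (enc_result (branch_dpvc (solve_dpvc k) (Suc k) v C))
      (Suc k * X + n * (200 * n + 500) + 100)" if "v \<le> A" for v
    proof (rule calls_branch_dpvc[OF that bndA Suc.prems(2,3) n(3)])
      fix c assume "c \<in> set (weights v C)"
      then obtain x b where "(v, c, x, b) \<in> set C" by (auto simp: set_weights)
      then show "small A (solve_dpvc k (assign v c C)) \<and> small A (add v c (solve_dpvc k (assign v c C)))"
        using small_mono[OF small_solve_dpvc[OF asg(1)] le[OF asg(2)]] Suc.prems(1)
          small_mono[OF small_add[OF small_solve_dpvc[OF asg(1)]] le[OF Suc.prems(2)]]
        by (auto simp: bnd_def)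
      show "calls N P 18 [enc (assign v c C), Num (Suc k - 1)] (enc_result (solve_dpvc k (assign v c C))) X"
        unfolding diff_Suc_1 X_def using Suc.prems(3) by (intro Suc.IH asg) simp
    qed
    have sm: "small A (branch_dpvc (solve_dpvc k) (Suc k) v C)" for v
      by (rule small_mono[OF small_branch_dpvc[OF small_solve_dpvc[OF asg(1)] Suc.prems(1)] le[OF Suc.prems(2)]])
    have ux: "u \<le> A" "x \<le> A" using bndA Cons d by (auto simp: bnd_def)
    have nodes: "K * dpvc_nodes (Suc k) = K + Suc k * X + Suc k * X" by (simp add: X_def algebra_simps)
    note unf = Cons d list.map encode_list.simps enc_clause.simps
    show ?thesis
      unfolding nodes unfolding unf
      by (rule callsI[OF _ code(18)[unfolded solve_dpvc_body_def]], simp add: length_P,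
        (rule ev_rules br[OF ux(1), unfolded unf] br[OF ux(2), unfolded unf] calls_better[OF sm sm, unfolded unf] |
          (simp add: bits_le Suc.prems(3); fail))+) (use K in auto)
  qed
qed

end

section \<open>From the search to a complete run\<close>

lemma derivable_length: "derivable C s L \<Longrightarrow> length L \<le> length C"
proof (induction rule: derivable.induct)
  case (2 v c C s L x b)
  then show ?case using length_assign_less[OF 2(2), of c] by simp
qed simp

definition answer :: "result \<Rightarrow> nat list \<Rightarrow> val" where
  "answer r vs = (case r of None \<Rightarrow> Num 0 | Some (s, L) \<Rightarrow> enc_nums (map (lookup L) vs))"

lemma (in machine) calls_finish:
  assumes "\<forall>v\<in>set vs. v \<le> A" "\<And>s L. r = Some (s, L) \<Longrightarrow> (\<forall>(u, c)\<in>set L. u \<le> A) \<and> length L \<le> n"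
  shows "calls N P 23 [enc_result r, enc_nums vs] (answer r vs) (length vs * (40 * n + 40) + 30)"
proof (cases r)
  case None
  show ?thesis
    unfolding None enc_result.simps
    by (rule callsI[OF _ code(23)[unfolded finish_body_def]], simp add: length_P,
       (rule ev_rules | (simp add: bits_le answer_def; fail))+)
next
  case (Some p)
  obtain s L where p: "p = (s, L)" by (cases p)
  have L: "\<forall>(u, c)\<in>set L. u \<le> A" "length L \<le> n" using assms(2) Some p by auto
  then have "length vs * (40 * length L + 40) \<le> length vs * (40 * n + 40)" by (intro mult_le_mono) auto
  then have out: "calls N P 22 [enc_nums vs, encode_list (map enc_pair L)] (enc_nums (map (lookup L) vs))
      (length vs * (40 * n + 40) + 10)"
    using calls_mono[OF calls_output[OF assms(1) L(1)]] by simp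
  show ?thesis
    unfolding Some p enc_result.simps
    by (rule callsI[OF _ code(23)[unfolded finish_body_def]], simp add: length_P,
       (rule ev_rules out | (simp add: bits_le answer_def; fail))+)
qed

lemma (in machine) calls_main:
  assumes "main = main_body f" "\<forall>v\<in>set vs. v \<le> A" "\<forall>(u, v)\<in>set as. u \<le> A \<and> v \<le> A \<and> (v, u) \<in> set as"
    and "calls N P f [enc (clauses w as), Num k] (enc_result r) X"
    and "\<And>s L. r = Some (s, L) \<Longrightarrow> (\<forall>(u, c)\<in>set L. u \<le> A) \<and> length L \<le> length as"
  shows "calls N P 0 [encode_input vs as w k] (answer r vs)
    (X + length as * (60 * length as + 80) + length vs * (40 * length as + 40) + 100)"
proof -
  have arcs: "(\<lambda>(u, v). Node (Node (Num u) (Num v)) (Num (w (u, v)))) = enc_arc w" by auto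
  have P0: "P ! 0 = main_body f" by (simp add: P assms(1))
  have cl: "calls N P 20 [encode_list (map (enc_arc w) as), encode_list (map (enc_arc w) as)] (enc (clauses w as))
      (length as * (60 * length as + 80) + 10)"
    by (rule calls_clauses) (use assms(3) in auto)
  show ?thesis
    unfolding encode_input_def arcs
    by (rule callsI[OF _ P0[unfolded main_body_def]], simp add: length_P,
       (rule ev_rules cl assms(4) calls_finish[OF assms(2,5)] | assumption | (simp; fail))+)
qed

text \<open>The two extra steps are the evaluation of the argument and the call itself.\<close>

lemma runsI:
  assumes "calls N P 0 [x] y c"
  shows "\<exists>t. runs P x y t \<and> t \<le> (c + 2) * (2 * N + 1)"
proof -
  have "ev N P [x] (Call 0 [Var 0]) y (c + 2)"
    by (rule ev_mono, (rule ev_rules assms)+) auto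
  then show ?thesis by (auto simp: ev_def runs_def)
qed

lemma length_le_val_size: "length xs \<le> val_size (encode_list xs)"
  by (induction xs) auto

lemma val_size_mem: "x \<in> set xs \<Longrightarrow> val_size x \<le> val_size (encode_list xs)"
  by (induction xs) auto

text \<open>A number in the input has at most \<open>z\<close> bits, as its bits are counted in the
  size of the input.\<close>

lemma input_bounds:
  assumes "z = val_size (encode_input vs as w k)"
  shows "length vs \<le> z" "length as \<le> z" "k \<le> 2 ^ z" "v \<in> set vs \<Longrightarrow> v \<le> 2 ^ z" "a \<in> set as \<Longrightarrow> w a \<le> 2 ^ z"
proof -
  have num: "m \<le> 2 ^ z" if "bits m \<le> z" for m using floorlog_leD[OF that] by simp
  let ?as = "map (\<lambda>(u, v). Node (Node (Num u) (Num v)) (Num (w (u, v)))) as"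
  have z: "val_size (encode_list (map Num vs)) \<le> z" "val_size (encode_list ?as) \<le> z" "bits k \<le> z"
    using assms by (simp_all add: encode_input_def)
  show "length vs \<le> z" "length as \<le> z"
    using length_le_val_size[of "map Num vs"] length_le_val_size[of ?as] z by simp_all
  show "k \<le> 2 ^ z" using num z by blast
  show "v \<le> 2 ^ z" if "v \<in> set vs"
    using val_size_mem[of "Num v" "map Num vs"] that z by (intro num) auto
  show "w a \<le> 2 ^ z" if "a \<in> set as"
  proof -
    obtain u v where "a = (u, v)" by (cases a)
    then show ?thesis
      using val_size_mem[of "Node (Node (Num u) (Num v)) (Num (w a))" ?as] that z(2) by (intro num) force
  qed
qed

section \<open>Solvability in parameterized time\<close>

context
  fixes G :: "nat pair_pre_digraph" and w as
  assumes inst: "dpvc_instance G w" and as: "set as = parcs G"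
begin

lemma graph: "(u, v) \<in> set as \<Longrightarrow> u \<in> pverts G \<and> v \<in> pverts G \<and> u \<noteq> v \<and> (v, u) \<in> set as \<and> 0 < w (u, v)"
proof -
  interpret pair_graph G using inst by (simp add: dpvc_instance_def)
  show "(u, v) \<in> set as \<Longrightarrow> u \<in> pverts G \<and> v \<in> pverts G \<and> u \<noteq> v \<and> (v, u) \<in> set as \<and> 0 < w (u, v)"
    using arc_fst_in_verts arc_snd_in_verts pair_no_loops arcs_symmetric inst
    unfolding as dpvc_instance_def by force
qed

lemma in_clauses: "(u, a, x, b) \<in> set (clauses w as) \<longleftrightarrow> (u, x) \<in> set as \<and> a = w (u, x) \<and> b = w (x, u)"
  by (auto simp: clauses_def)

lemma over_clauses: "over (pverts G) (clauses w as)"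
  using graph by (auto simp: over_def in_clauses)

lemma coherent_clauses: "coherent (clauses w as)"
  using graph by (auto simp: coherent_def symm_def in_clauses)

lemma plain_clauses: "pvc_instance G w \<Longrightarrow> plain (clauses w as)"
  using graph coherent_clauses by (fastforce simp: plain_def in_clauses pvc_instance_def as)

lemma feasible_iff: "feasible G w p \<longleftrightarrow> (\<forall>v\<in>pverts G. 0 \<le> p v) \<and> sat p (clauses w as)"
  by (auto simp: feasible_def sat_def in_clauses as)

text \<open>The computed powers are integral and feasible and cost no more than a real optimum, so
  they are optimal among all real solutions.\<close>

lemma optimal_output:
  assumes "optimal G w p" "achieves r (total_power G p)"
    "\<And>s L. r = Some (s, L) \<Longrightarrow> derivable (clauses w as) s L"
  shows "is_optimal_output G w vs (answer r vs)"
proof -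
  obtain s L where r: "r = Some (s, L)" "real s \<le> total_power G p"
    using assms(2) by (auto simp: achieves_def)
  have d: "derivable (clauses w as) s L" using assms(3) r(1) .
  have "symm (clauses w as)" using coherent_clauses by (simp add: coherent_def)
  with d have "feasible G w (\<lambda>v. real (lookup L v))"
    unfolding feasible_iff using derivable_sat by auto
  moreover have "(\<Sum>v\<in>pverts G. lookup L v) = s"
  proof (rule derivable_sum[OF d])
    show "finite (pverts G)"
      using inst by (simp add: dpvc_instance_def pair_graph_def pair_digraph_def pair_fin_digraph.pair_finite_verts)
  qed (use over_clauses in \<open>auto simp: over_def\<close>)
  then have "total_power G (\<lambda>v. real (lookup L v)) = s" unfolding total_power_def by (metis of_nat_sum)
  ultimately have "optimal G w (\<lambda>v. real (lookup L v))"
    using assms(1) r(2) by (force simp: optimal_def)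
  then show ?thesis unfolding is_optimal_output_def answer_def r(1)
    by (intro exI[of _ "lookup L"]) (simp add: comp_def)
qed

end

lemma solvable_in_O_starI:
  fixes solve :: "nat \<Rightarrow> clause list \<Rightarrow> result" and nodes :: "nat \<Rightarrow> nat"
  assumes inst: "\<And>G w. inst G w \<Longrightarrow> dpvc_instance G w"
    and calls: "\<And>P N A B C n k. machine P N A (main_body f) \<Longrightarrow> n * B \<le> A \<Longrightarrow> B \<le> A \<Longrightarrow> n \<le> A \<Longrightarrow>
      bnd B C \<Longrightarrow> length C \<le> n \<Longrightarrow> k \<le> A \<Longrightarrow>
      calls N P f [enc C, Num k] (enc_result (solve k C)) (1200 * (n + 1)\<^sup>2 * nodes k)"
    and nodes: "\<And>k. 1 \<le> nodes k" "\<And>k. real (nodes k) \<le> 4 * g k"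
    and derivable: "\<And>G w as k s L. inst G w \<Longrightarrow> set as = parcs G \<Longrightarrow> solve k (clauses w as) = Some (s, L) \<Longrightarrow>
      derivable (clauses w as) s L"
    and achieves: "\<And>G w as k p. inst G w \<Longrightarrow> set as = parcs G \<Longrightarrow> finite (pverts G) \<Longrightarrow> feasible G w p \<Longrightarrow>
      positives (pverts G) p \<le> k \<Longrightarrow> achieves (solve k (clauses w as)) (\<Sum>v\<in>pverts G. p v)"
  shows "solvable_in_O_star inst g"
  unfolding solvable_in_O_star_def
\<comment> \<open>The constant is \<open>1500 * 4 * 4\<close>: at most
  \<open>1500 * (z + 1)\<^sup>2\<close> steps per node, each of cost at most
  \<open>4 * (z + 1)\<close>, and a factor 4 from the bound on \<open>nodes\<close>.\<close>
proof (intro exI[of _ "main_body f # common"] exI[of _ "smult 24000 ([:1, 1:] ^ 3)"] allI impI, elim conjE)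
  let ?P = "main_body f # common"
  fix G w vs as k
  assume G: "inst G w" and vs: "distinct vs" "set vs = pverts G" and as: "distinct as" "set as = parcs G"
  let ?r = "solve k (clauses w as)"
  define z where "z = val_size (encode_input vs as w k)"
  \<comment> \<open>Input numbers are at most \<open>2 ^ z\<close>, and there are at most
    \<open>z \<le> 2 ^ z\<close> clauses, so costs stay below the square of
    \<open>2 ^ z\<close>.\<close>
  define A :: nat where "A = 2 ^ (2 * z)"
  let ?B = "2 ^ z :: nat"
  note ib = input_bounds[OF z_def]
  note graph = graph[OF inst[OF G] as(2)]
  have A: "A = ?B * ?B" by (simp add: A_def mult_2 power_add)
  have "z \<le> ?B" by (simp add: less_imp_le)
  moreover have "?B \<le> ?B * ?B" by simp
  ultimately have le: "z * ?B \<le> A" "?B \<le> A" "z \<le> A"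
    unfolding A by (intro mult_le_mono1, simp, simp, linarith)
  \<comment> \<open>The bound \<open>A\<close> itself is a power of two and takes
    \<open>2 * z + 1\<close> bits.\<close>
  interpret machine ?P "2 * z + 1" A "main_body f"
  proof
    fix m assume "m \<le> A"
    also have "A < 2 ^ (2 * z + 1)" by (simp add: A_def)
    finally show "bits m \<le> 2 * z + 1" by (intro floorlog_leI) auto
  qed (simp_all add: A_def)
  have bnd: "bnd ?B (clauses w as)"
    unfolding bnd_def clauses_def using graph ib(4,5) vs by auto
  have verts: "\<forall>v\<in>set vs. v \<le> A" using ib(4) le(2) le_trans by blast
  have arcs: "\<forall>(u, v)\<in>set as. u \<le> A \<and> v \<le> A \<and> (v, u) \<in> set as" using graph verts vs(2) by auto
  have "calls (2 * z + 1) ?P f [enc (clauses w as), Num k] (enc_result ?r) (1200 * (z + 1)\<^sup>2 * nodes k)"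
    by (rule calls[OF machine_axioms le bnd]) (use ib(2,3) le(2) in \<open>auto simp: clauses_def\<close>)
  moreover have "(\<forall>(u, c)\<in>set L. u \<le> A) \<and> length L \<le> length as" if "?r = Some (s, L)" for s L
    using derivable_bound[OF derivable[OF G as(2) that] bnd] derivable_length[OF derivable[OF G as(2) that]] le(2)
    by (fastforce simp: clauses_def)
  ultimately have "calls (2 * z + 1) ?P 0 [encode_input vs as w k] (answer ?r vs)
      (1200 * (z + 1)\<^sup>2 * nodes k + length as * (60 * length as + 80) + length vs * (40 * length as + 40) + 100)"
    by (intro calls_main verts arcs) auto
  from runsI[OF this] obtain t where t: "runs ?P (encode_input vs as w k) (answer ?r vs) t"
    "t \<le> (1200 * (z + 1)\<^sup>2 * nodes k + length as * (60 * length as + 80) + length vs * (40 * length as + 40) + 100 + 2)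
      * (2 * (2 * z + 1) + 1)"
    by blast
  have "length as * (60 * length as + 80) \<le> z * (60 * z + 80)"
    "length vs * (40 * length as + 40) \<le> z * (40 * z + 40)"
    using ib(1,2) by (intro mult_le_mono; simp)+
  moreover have "z * (60 * z + 80) + z * (40 * z + 40) + 102 \<le> 300 * (z + 1)\<^sup>2"
    by (simp add: power2_eq_square algebra_simps)
  moreover have "300 * (z + 1)\<^sup>2 \<le> 300 * (z + 1)\<^sup>2 * nodes k" using nodes(1)[of k] by simp
  ultimately have "1200 * (z + 1)\<^sup>2 * nodes k + length as * (60 * length as + 80) + length vs * (40 * length as + 40) + 100 + 2
      \<le> 1500 * (z + 1)\<^sup>2 * nodes k"
    by linarith
  moreover have "2 * (2 * z + 1) + 1 \<le> 4 * (z + 1)" by simp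
  ultimately have "t \<le> (1500 * (z + 1)\<^sup>2 * nodes k) * (4 * (z + 1))"
    using t(2) mult_le_mono le_trans by blast
  also have "\<dots> = 6000 * (z + 1) ^ 3 * nodes k"
  proof -
    have "(1500 * x\<^sup>2 * n) * (4 * x) = 6000 * x ^ 3 * n" for x n :: nat
      by (simp add: power2_eq_square power3_eq_cube)
    then show ?thesis .
  qed
  finally have "real t \<le> real (6000 * (z + 1) ^ 3 * nodes k)" by linarith
  also have "\<dots> = 6000 * real ((z + 1) ^ 3) * real (nodes k)" by simp
  also have "\<dots> \<le> 6000 * real ((z + 1) ^ 3) * (4 * g k)" using nodes(2) by (intro mult_left_mono) auto
  also have "\<dots> = real (poly (smult 24000 ([:1, 1:] ^ 3)) z) * g k" by (simp add: poly_power add.commute)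
  finally have "real t \<le> real (poly (smult 24000 ([:1, 1:] ^ 3)) z) * g k" .
  moreover have "is_optimal_output G w vs (answer ?r vs)" if "optimal G w p" "num_positive G p = k" for p
  proof (rule optimal_output[OF inst[OF G] as(2) that(1)])
    show "achieves ?r (total_power G p)"
      unfolding total_power_def using that vs(2)
      by (intro achieves G as) (auto simp: optimal_def num_positive_def positives_def, metis List.finite_set)
  qed (rule derivable[OF G as(2)])
  ultimately show "\<exists>y t. runs ?P (encode_input vs as w k) y t \<and>
      real t \<le> real (poly (smult 24000 ([:1, 1:] ^ 3)) (val_size (encode_input vs as w k))) * g k \<and>
      ((\<exists>p. optimal G w p \<and> num_positive G p = k) \<longrightarrow> is_optimal_output G w vs y)"
    using t(1) unfolding z_def by blast
qed

section \<open>Size of the search trees\<close>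

text \<open>Adding 1 turns the recurrence into that of the Fibonacci numbers, and 1.619 exceeds the
  golden ratio: its square is at least \<open>1.619 + 1\<close>.\<close>

lemma pvc_nodes_bound: "real (pvc_nodes k) + 1 \<le> 4 * 1.619 ^ k"
proof (induction k rule: pvc_nodes.induct)
  case (2 k)
  show ?case
  proof (cases k)
    case 0
    then show ?thesis by simp
  next
    case (Suc j)
    have "real (pvc_nodes (Suc k)) + 1 \<le> 4 * 1.619 ^ Suc j + 4 * 1.619 ^ j"
      using 2 Suc by simp
    also have "\<dots> = 4 * 1.619 ^ j * (2.619 :: real)" by simp
    also have "\<dots> \<le> 4 * 1.619 ^ j * (1.619 * 1.619)" by (intro mult_left_mono) auto
    finally show ?thesis using Suc by simp
  qed
qed simp

text \<open>The shift by 1 absorbs the additive term of the recurrence, because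
  \<open>2 \<le> 2 * Suc k\<close>.\<close>

lemma dpvc_nodes_bound: "dpvc_nodes k + 1 \<le> 2 * 2 ^ k * fact k"
proof (induction k)
  case (Suc k)
  have "dpvc_nodes (Suc k) + 1 + 2 * k \<le> 2 * Suc k * (dpvc_nodes k + 1)" by (simp add: algebra_simps)
  also have "\<dots> \<le> 2 * Suc k * (2 * 2 ^ k * fact k)" by (intro mult_left_mono Suc) simp
  finally show ?case by (simp add: algebra_simps)
qed simp

text \<open>Bernoulli's inequality gives \<open>2 * n ^ n \<le> (n + 1) ^ n\<close>, so the factor \<open>2 ^ n\<close> is paid for by \<open>fact n\<close>.\<close>

lemma two_power_fact_bound: "(2 :: real) ^ k * fact k \<le> 2 * real k ^ k"
proof (induction k)
  case (Suc k)
  have bern: "2 * real k ^ k \<le> real (Suc k) ^ k" if "k > 0"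
  proof -
    have "1 + real k * (1 / real k) \<le> (1 + 1 / real k) ^ k" by (rule Bernoulli_inequality) (simp add: order_trans[of _ 0])
    then have "2 * real k ^ k \<le> (1 + 1 / real k) ^ k * real k ^ k" using that by (intro mult_right_mono) auto
    also have "\<dots> = real (Suc k) ^ k" using that by (simp add: power_mult_distrib[symmetric] field_simps)
    finally show ?thesis .
  qed
  show ?case
  proof (cases "k = 0")
    case False
    have "(2 :: real) ^ Suc k * fact (Suc k) = 2 * real (Suc k) * (2 ^ k * fact k)" by (simp add: algebra_simps)
    also have "\<dots> \<le> 2 * real (Suc k) * (2 * real k ^ k)" by (intro mult_left_mono Suc) simp
    also have "\<dots> \<le> 2 * real (Suc k) * real (Suc k) ^ k" using bern False by (intro mult_left_mono) auto
    finally show ?thesis by (simp add: algebra_simps)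
  qed simp
qed simp

theorem theorem8:
  shows "solvable_in_O_star pvc_instance (\<lambda>k. 1.619 ^ k) \<and>
    solvable_in_O_star dpvc_instance (\<lambda>k. real k ^ k)"
proof
  show "solvable_in_O_star pvc_instance (\<lambda>k. 1.619 ^ k)"
  \<comment> \<open>Function 11 is \<open>solve_pvc\<close>; in the other half, function 18 is
    \<open>solve_dpvc\<close>. The constant 1200 covers the cost of a node in both.\<close>
  proof (rule solvable_in_O_starI[of _ 11 solve_pvc pvc_nodes])
    fix G w assume "pvc_instance G w"
    then show d: "dpvc_instance G w" by (simp add: pvc_instance_def)
  next
    fix P N A B C n k
    assume m: "machine P N A (main_body 11)" and "n * B \<le> A" "B \<le> A" "bnd B C" "length C \<le> n" "k \<le> A"
    moreover have "n * (80 * n + 120) + 1000 * n + 1000 \<le> 1200 * (n + 1)\<^sup>2"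
      by (simp add: power2_eq_square algebra_simps)
    ultimately show "calls N P 11 [enc C, Num k] (enc_result (solve_pvc k C)) (1200 * (n + 1)\<^sup>2 * pvc_nodes k)"
      by (intro machine.calls_solve_pvc[OF m])
  next
    fix k
    show "1 \<le> pvc_nodes k" by (cases k) auto
    show "real (pvc_nodes k) \<le> 4 * 1.619 ^ k" using pvc_nodes_bound[of k] by linarith
  next
    fix G w as k s L
    assume G: "pvc_instance G w" "set as = parcs G" and "solve_pvc k (clauses w as) = Some (s, L)"
    moreover have "dpvc_instance G w" using G(1) by (simp add: pvc_instance_def)
    ultimately show "derivable (clauses w as) s L"
      by (intro solve_pvc_derivable[of k _ s L "pverts G"] plain_clauses over_clauses)
  next
    fix G w as k p
    assume G: "pvc_instance G w" "set as = parcs G" "finite (pverts G)" "feasible G w p" "positives (pverts G) p \<le> k"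
    then have d: "dpvc_instance G w" by (simp add: pvc_instance_def)
    show "achieves (solve_pvc k (clauses w as)) (\<Sum>v\<in>pverts G. p v)"
      using G(4) unfolding feasible_iff[OF d G(2)]
      by (intro achieves_solve_pvc plain_clauses[OF d G(2,1)] over_clauses[OF d G(2)] G) auto
  qed
  show "solvable_in_O_star dpvc_instance (\<lambda>k. real k ^ k)"
  proof (rule solvable_in_O_starI[of _ 18 solve_dpvc dpvc_nodes])
    fix P N A B C n k
    assume m: "machine P N A (main_body 18)" and "n * B \<le> A" "B \<le> A" "n \<le> A" "bnd B C" "length C \<le> n" "k \<le> A"
    moreover have "2 * n * (200 * n + 500) + 300 \<le> 1200 * (n + 1)\<^sup>2"
      by (simp add: power2_eq_square algebra_simps)
    ultimately show "calls N P 18 [enc C, Num k] (enc_result (solve_dpvc k C)) (1200 * (n + 1)\<^sup>2 * dpvc_nodes k)"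
      by (intro machine.calls_solve_dpvc[OF m])
  next
    fix k
    show "1 \<le> dpvc_nodes k" by (cases k) auto
    have "real (dpvc_nodes k + 1) \<le> real (2 * 2 ^ k * fact k)" using dpvc_nodes_bound[of k] by (rule of_nat_mono)
    \<comment> \<open>This includes \<open>k = 0\<close>, where \<open>0 ^ 0 = 1\<close>.\<close>
    then show "real (dpvc_nodes k) \<le> 4 * real k ^ k" using two_power_fact_bound[of k] by simp
  next
    fix G w as k s L
    assume "solve_dpvc k (clauses w as) = Some (s, L)"
    then show "derivable (clauses w as) s L" by (rule solve_dpvc_derivable)
  next
    fix G w as k p
    assume G: "dpvc_instance G w" "set as = parcs G" "finite (pverts G)" "feasible G w p" "positives (pverts G) p \<le> k"
    show "achieves (solve_dpvc k (clauses w as)) (\<Sum>v\<in>pverts G. p v)"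
      using G(4) unfolding feasible_iff[OF G(1,2)]
      by (intro achieves_solve_dpvc coherent_clauses[OF G(1,2)] over_clauses[OF G(1,2)] G) auto
  qed
qed

end
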